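(* Let $\mathbb{X}$ be a finite set, $p_X$ a probability mass function on $\mathbb{X}$ with $p_X(x)>0$ for all $x$, $\mathcal{H}_A$ a finite-dimensional Hilbert space, and $\{\rho_A^x\}_{x\in\mathbb{X}}$ density operators on $\mathcal{H}_A$, forming the ensemble $\mathcal{E}=\{p_X(x),\rho_A^x\}_{x\in\mathbb{X}}$. Then \[ I_{acc}(\mathcal{E})\leq\chi(\mathcal{E})\leq\mathcal{B}(X\rightarrow A)_{\rho_A}\leq\mathcal{R}(X\rightarrow A)_{\rho_A}. \]
   Context: All logarithms are base 2. Accessible information: $I_{acc}(\mathcal{E})=\sup_{\{F_y\}}I_1(X;Y)$, where the supremum is over POVMs $\{F_y\}_{y\in\mathbb{Y}}$ on $\mathcal{H}_A$ with finite outcome set, $Y$ is the outcome with $\mathbb{P}\{Y=y\mid X=x\}=\operatorname{tr}(\rho_A^xF_y)$, and $I_1$ is the (Shannon) mutual information of $(X,Y)$ with $X\sim p_X$. Holevo information: $\chi(\mathcal{E})=H(\rho_A)-\sum_{x}p_X(x)H(\rho_A^x)$ with $\rho_A=\sum_xp_X(x)\rho_A^x$ and $H(\rho)=-\operatorname{tr}(\rho\log\rho)$. For a density operator $\rho$ and positive semi-definite $\sigma$, $\widetilde{D}_\infty(\rho\|\sigma)=\log\inf\{\mu\in\mathbb{R}:\rho\leq\mu\sigma\}$ ($+\infty$ if $\operatorname{supp}\rho\not\subseteq\operatorname{supp}\sigma$). $\Delta(\mathbb{X})$ is the set of probability mass functions on $\mathbb{X}$; $\mathcal{B}(X\rightarrow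 A)_{\rho_A}=\min_{\pi\in\Delta(\mathbb{X})}\max_{x}\widetilde{D}_\infty\big(\rho_A^x\|\sum_{x'}\pi(x')\rho_A^{x'}\big)$ and $\mathcal{R}(X\rightarrow A)_{\rho_A}=\max_{x,x'}\widetilde{D}_\infty(\rho_A^x\|\rho_A^{x'})$. *)

theory Defs
  imports "HOL-Analysis.Analysis" "Jordan_Normal_Form.Char_Poly"
begin

text \<open>Operators on the finite-dimensional Hilbert space H_A = C^d are d x d complex matrices.\<close>

definition mtrace :: "complex mat \<Rightarrow> complex" where
  "mtrace A = (\<Sum>i<dim_row A. A $$ (i,i))"

definition psd :: "nat \<Rightarrow> complex mat \<Rightarrow> bool" where
  "psd d A \<longleftrightarrow> A \<in> carrier_mat d d \<and>
     (\<forall>v \<in> carrier_vec d. let z = (\<Sum>i<d. cnj (v $ i) * (A *\<^sub>v v) $ i) in Im z = 0 \<and> 0 \<le> Re z)"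

definition density :: "nat \<Rightarrow> complex mat \<Rightarrow> bool" where
  "density d A \<longleftrightarrow> psd d A \<and> mtrace A = 1"

definition msum :: "nat \<Rightarrow> 'i set \<Rightarrow> ('i \<Rightarrow> complex mat) \<Rightarrow> complex mat" where
  "msum d S f = mat d d (\<lambda>(i,j). \<Sum>s\<in>S. f s $$ (i,j))"

definition povm :: "nat \<Rightarrow> nat set \<Rightarrow> (nat \<Rightarrow> complex mat) \<Rightarrow> bool" where
  "povm d Y F \<longleftrightarrow> finite Y \<and> (\<forall>y\<in>Y. psd d (F y)) \<and> msum d Y F = 1\<^sub>m d"

definition eta :: "real \<Rightarrow> real" where
  "eta t = (if t \<le> 0 then 0 else t * log 2 t)"

text \<open>von Neumann entropy H(rho) = - tr(rho log rho) = - sum over eigenvalues (with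
  algebraic multiplicity) of lambda log lambda, with 0 log 0 = 0.\<close>
definition vn_entropy :: "complex mat \<Rightarrow> real" where
  "vn_entropy A = - (\<Sum>l\<in>{l. poly (char_poly A) l = 0}.
        real (order l (char_poly A)) * eta (Re l))"

definition mutual_info :: "'x set \<Rightarrow> ('x \<Rightarrow> real) \<Rightarrow> nat set \<Rightarrow> ('x \<Rightarrow> nat \<Rightarrow> real) \<Rightarrow> real" where
  "mutual_info X p Y W =
     (\<Sum>x\<in>X. \<Sum>y\<in>Y. let pxy = p x * W x y; py = (\<Sum>x'\<in>X. p x' * W x' y) in
        (if pxy = 0 then 0 else pxy * log 2 (pxy / (p x * py))))"

definition accessible_info :: "nat \<Rightarrow> 'x set \<Rightarrow> ('x \<Rightarrow> real) \<Rightarrow> ('x \<Rightarrow> complex mat) \<Rightarrow> ereal" where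
  "accessible_info d X p \<rho> =
     (SUP YF \<in> {(Y, F). povm d Y F}.
        ereal (mutual_info X p (fst YF) (\<lambda>x y. Re (mtrace (\<rho> x * snd YF y)))))"

definition avg_state :: "nat \<Rightarrow> 'x set \<Rightarrow> ('x \<Rightarrow> real) \<Rightarrow> ('x \<Rightarrow> complex mat) \<Rightarrow> complex mat" where
  "avg_state d X p \<rho> = msum d X (\<lambda>x. complex_of_real (p x) \<cdot>\<^sub>m \<rho> x)"

definition holevo_info :: "nat \<Rightarrow> 'x set \<Rightarrow> ('x \<Rightarrow> real) \<Rightarrow> ('x \<Rightarrow> complex mat) \<Rightarrow> real" where
  "holevo_info d X p \<rho> = vn_entropy (avg_state d X p \<rho>) - (\<Sum>x\<in>X. p x * vn_entropy (\<rho> x))"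

text \<open>Max-relative entropy: log inf {mu. rho <= mu sigma}, which is +infinity when the set is
  empty (equivalently, supp rho not contained in supp sigma).\<close>
definition D_max :: "nat \<Rightarrow> complex mat \<Rightarrow> complex mat \<Rightarrow> ereal" where
  "D_max d \<rho> \<sigma> =
     (let S = {\<mu>::real. psd d (complex_of_real \<mu> \<cdot>\<^sub>m \<sigma> - \<rho>)} in
      if S = {} then \<infinity> else ereal (log 2 (Inf S)))"

definition pmfs_on :: "'x set \<Rightarrow> ('x \<Rightarrow> real) set" where
  "pmfs_on X = {\<pi>. (\<forall>x\<in>X. 0 \<le> \<pi> x) \<and> (\<Sum>x\<in>X. \<pi> x) = 1}"

definition B_quant :: "nat \<Rightarrow> 'x set \<Rightarrow> ('x \<Rightarrow> complex mat) \<Rightarrow> ereal" where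
  "B_quant d X \<rho> =
     (INF \<pi> \<in> pmfs_on X. Max ((\<lambda>x. D_max d (\<rho> x) (avg_state d X \<pi> \<rho>)) ` X))"

definition R_quant :: "nat \<Rightarrow> 'x set \<Rightarrow> ('x \<Rightarrow> complex mat) \<Rightarrow> ereal" where
  "R_quant d X \<rho> = Max ((\<lambda>(x, x'). D_max d (\<rho> x) (\<rho> x')) ` (X \<times> X))"

end

theory Submission
  imports Defs "Jordan_Normal_Form.Schur_Decomposition" "HOL-Real_Asymp.Real_Asymp"
begin

text \<open>Write \<open>D\<close> for the relative entropy. For every state \<open>\<sigma>\<close> dominating the ensemble, the averages
  satisfy \<open>\<Sum>x. p x D(\<rho> x, \<sigma>) = \<chi> + D(\<rho>, \<sigma>)\<close>, where \<open>\<rho>\<close> is the average state. With \<open>\<sigma> = \<rho>\<close> the first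
  inequality reduces to the monotonicity of \<open>D\<close> under measurements, and with \<open>\<sigma>\<close> a mixture of the
  states the second one reduces to \<open>D \<ge> 0\<close> and \<open>D \<le> D_max\<close>.

  For eigenvectors \<open>u i\<close>, \<open>v j\<close> and eigenvalues \<open>\<lambda>\<^sub>i\<close>, \<open>\<mu>\<^sub>j\<close> of \<open>\<rho>\<close>, \<open>\<sigma>\<close> and overlaps \<open>P i j\<close>, \<open>D\<close> is the
  classical quantity \<open>- \<Sum>i j. \<lambda>\<^sub>i P i j log (\<mu>\<^sub>j / \<lambda>\<^sub>i)\<close>. As \<open>- log x\<close> is an integral of the functions
  \<open>1 / (x + t)\<close>, up to a constant, it suffices for monotonicity to compare the resolvent sums
  \<open>\<Sum>i j. \<lambda>\<^sub>i P i j / (\<mu>\<^sub>j / \<lambda>\<^sub>i + t)\<close> with their classical counterparts for each \<open>t\<close>. Such a sum is the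
  maximum over \<open>X\<close> of \<open>2 Re tr (\<rho> X) - tr (X\<^sup>* \<sigma> X) - t tr (X \<rho> X\<^sup>*)\<close>, and the trial operator
  \<open>X = \<Sum>y. a y F y\<close> with \<open>a y = q y / (r y + t q y)\<close> yields the classical value, where \<open>q\<close> and \<open>r\<close> are
  the outcome distributions. Nonnegativity of \<open>D\<close> is the case of the trivial measurement.\<close>

section \<open>The spectral theorem for positive semidefinite matrices\<close>

definition ip :: "nat \<Rightarrow> (nat \<Rightarrow> complex) \<Rightarrow> (nat \<Rightarrow> complex) \<Rightarrow> complex" where
  "ip d v w = (\<Sum>k<d. cnj (v k) * w k)"

text \<open>Vectors are coordinate functions of which only the indices below \<open>d\<close> count.
  This avoids carrier side conditions; vectors agreeing below \<open>d\<close> are exchanged by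
  \<open>ip_cong\<close>.\<close>

definition app :: "nat \<Rightarrow> complex mat \<Rightarrow> (nat \<Rightarrow> complex) \<Rightarrow> nat \<Rightarrow> complex" where
  "app d A v k = (\<Sum>l<d. A $$ (k,l) * v l)"

lemma ip_cong: "(\<And>k. k < d \<Longrightarrow> v k = v' k) \<Longrightarrow> (\<And>k. k < d \<Longrightarrow> w k = w' k) \<Longrightarrow> ip d v w = ip d v' w'"
  by (simp add: ip_def)

lemma ip_add_right: "ip d v (\<lambda>k. w k + w' k) = ip d v w + ip d v w'"
  by (simp add: ip_def sum.distrib algebra_simps)

lemma ip_add_left: "ip d (\<lambda>k. v k + v' k) w = ip d v w + ip d v' w"
  by (simp add: ip_def sum.distrib algebra_simps)

lemma ip_diff_right: "ip d v (\<lambda>k. w k - w' k) = ip d v w - ip d v w'"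
  by (simp add: ip_def sum_subtractf algebra_simps)

lemma ip_diff_left: "ip d (\<lambda>k. v k - v' k) w = ip d v w - ip d v' w"
  by (simp add: ip_def sum_subtractf algebra_simps)

lemma ip_scale_right: "ip d v (\<lambda>k. c * w k) = c * ip d v w"
  by (simp add: ip_def sum_distrib_left algebra_simps)

lemma ip_scale_left: "ip d (\<lambda>k. c * v k) w = cnj c * ip d v w"
  by (simp add: ip_def sum_distrib_left algebra_simps)

lemma ip_sum_right: "ip d v (\<lambda>k. \<Sum>s\<in>S. f s k) = (\<Sum>s\<in>S. ip d v (f s))"
  by (simp add: ip_def sum_distrib_left sum.swap[of _ S])

lemma ip_sum_left: "ip d (\<lambda>k. \<Sum>s\<in>S. f s k) w = (\<Sum>s\<in>S. ip d (f s) w)"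
  by (simp add: ip_def sum_distrib_right sum.swap[of _ S])

lemma ip_cnj: "cnj (ip d v w) = ip d w v"
  by (simp add: ip_def mult.commute)

lemma ip_self: "ip d v v = of_real (\<Sum>k<d. (cmod (v k))\<^sup>2)"
  unfolding of_real_sum complex_norm_square by (simp add: ip_def mult.commute)

lemma app_add: "app d A (\<lambda>k. v k + w k) = (\<lambda>k. app d A v k + app d A w k)"
  by (simp add: app_def sum.distrib algebra_simps fun_eq_iff)

lemma app_diff: "app d A (\<lambda>k. v k - w k) = (\<lambda>k. app d A v k - app d A w k)"
  by (simp add: app_def sum_subtractf algebra_simps fun_eq_iff)

lemma app_scale: "app d A (\<lambda>k. c * v k) = (\<lambda>k. c * app d A v k)"
  by (simp add: app_def sum_distrib_left algebra_simps fun_eq_iff)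

lemma app_mult_mat_vec:
  "A \<in> carrier_mat d d \<Longrightarrow> v \<in> carrier_vec d \<Longrightarrow> k < d \<Longrightarrow> (A *\<^sub>v v) $ k = app d A (vec_index v) k"
  by (auto simp: app_def scalar_prod_def atLeast0LessThan)

lemma psdD:
  assumes "psd d A"
  shows "A \<in> carrier_mat d d" "Im (ip d v (app d A v)) = 0" "0 \<le> Re (ip d v (app d A v))"
proof -
  show A: "A \<in> carrier_mat d d" using assms by (simp add: psd_def)
  have eq: "(\<Sum>i<d. cnj (vec d v $ i) * (A *\<^sub>v vec d v) $ i) = ip d v (app d A v)"
    unfolding ip_def
  proof (rule sum.cong)
    fix i assume i: "i \<in> {..<d}"
    have "(A *\<^sub>v vec d v) $ i = app d A (vec_index (vec d v)) i"
      using A i by (intro app_mult_mat_vec) auto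
    also have "\<dots> = app d A v i" by (simp add: app_def)
    finally show "cnj (vec d v $ i) * (A *\<^sub>v vec d v) $ i = cnj (v i) * app d A v i"
      using i by simp
  qed simp
  have "vec d v \<in> carrier_vec d" by simp
  then show "Im (ip d v (app d A v)) = 0" "0 \<le> Re (ip d v (app d A v))"
    using assms unfolding psd_def Let_def eq[symmetric] by blast+
qed

lemma psdI:
  assumes "A \<in> carrier_mat d d" "\<And>v. Im (ip d v (app d A v)) = 0" "\<And>v. 0 \<le> Re (ip d v (app d A v))"
  shows "psd d A"
proof -
  have "(\<Sum>i<d. cnj (v $ i) * (A *\<^sub>v v) $ i) = ip d (vec_index v) (app d A (vec_index v))"
    if "v \<in> carrier_vec d" for v
    unfolding ip_def using assms(1) that by (intro sum.cong) (auto simp del: index_mult_mat_vec simp: app_mult_mat_vec)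
  then show ?thesis using assms by (simp add: psd_def Let_def)
qed

text \<open>Polarization: realness of the form at \<open>v + w\<close> relates the imaginary parts
  of \<open>ip d v (app d A w)\<close> and \<open>ip d w (app d A v)\<close>, and realness at
  \<open>v + \<i> * w\<close> relates their real parts; so they are conjugate.\<close>

lemma psd_hermitian:
  assumes "psd d A"
  shows "ip d v (app d A w) = ip d (app d A v) w"
proof -
  have 1: "ip d v (app d A w) + ip d w (app d A v) \<in> \<real>" for v w
  proof -
    have "ip d (\<lambda>k. v k + w k) (app d A (\<lambda>k. v k + w k)) - ip d v (app d A v) - ip d w (app d A w) \<in> \<real>"
      using psdD(2)[OF assms] by (intro Reals_diff) (simp_all add: complex_is_Real_iff)
    also have "ip d (\<lambda>k. v k + w k) (app d A (\<lambda>k. v k + w k)) - ip d v (app d A v) - ip d w (app d A w)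
       = ip d v (app d A w) + ip d w (app d A v)"
      by (simp add: app_add ip_add_left ip_add_right)
    finally show ?thesis .
  qed
  have a: "Im (ip d v (app d A w) + ip d w (app d A v)) = 0"
    using 1 by (simp add: complex_is_Real_iff)
  have "Im (ip d v (app d A (\<lambda>k. \<i> * w k)) + ip d (\<lambda>k. \<i> * w k) (app d A v)) = 0"
    using 1 by (simp add: complex_is_Real_iff)
  then have b: "Re (ip d v (app d A w)) - Re (ip d w (app d A v)) = 0"
    by (simp add: app_scale ip_scale_left ip_scale_right)
  have "ip d v (app d A w) = cnj (ip d w (app d A v))"
    using a b by (simp add: complex_eq_iff)
  then show ?thesis by (simp add: ip_cnj)
qed

section \<open>Traces and characteristic roots\<close>

lemma mtrace_eq: "A \<in> carrier_mat d d \<Longrightarrow> mtrace A = (\<Sum>i<d. A $$ (i,i))"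
  by (auto simp: mtrace_def)

lemma mult_mat_index:
  assumes "A \<in> carrier_mat d d" "B \<in> carrier_mat d d" "i < d" "j < d"
  shows "(A * B) $$ (i,j) = (\<Sum>k<d. A $$ (i,k) * B $$ (k,j))"
  using assms by (auto simp: scalar_prod_def atLeast0LessThan)

lemma mtrace_mult_commute:
  assumes "A \<in> carrier_mat d d" "B \<in> carrier_mat d d"
  shows "mtrace (A * B) = mtrace (B * A)"
proof -
  have "mtrace (A * B) = (\<Sum>i<d. \<Sum>k<d. A $$ (i,k) * B $$ (k,i))"
    using assms by (subst mtrace_eq[of _ d]) (auto simp del: index_mult_mat simp: mult_mat_index)
  also have "\<dots> = (\<Sum>k<d. \<Sum>i<d. B $$ (k,i) * A $$ (i,k))"
    by (subst sum.swap) (simp add: mult.commute)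
  also have "\<dots> = mtrace (B * A)"
    using assms by (subst mtrace_eq[of _ d]) (auto simp del: index_mult_mat simp: mult_mat_index)
  finally show ?thesis .
qed

text \<open>Schur triangularization makes \<open>A\<close> similar to a triangular matrix with
  diagonal \<open>as\<close>, and cyclicity makes the trace invariant under similarity.\<close>

lemma mtrace_eq_sum_roots:
  assumes A: "A \<in> carrier_mat d d" and cp: "char_poly A = (\<Prod>a\<leftarrow>as. [:- a, 1:])"
  shows "mtrace A = sum_list as"
proof -
  obtain B P Q where "schur_decomposition A as = (B,P,Q)"
    by (cases "schur_decomposition A as") auto
  from schur_decomposition[OF A cp this]
  have sim: "similar_mat_wit A B P Q" and diag: "diag_mat B = as" by auto
  note w = similar_mat_witD2[OF A sim]
  have "mtrace A = mtrace (P * (B * Q))" using w by (simp add: assoc_mult_mat)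
  also have "\<dots> = mtrace ((B * Q) * P)" using w by (intro mtrace_mult_commute) auto
  also have "(B * Q) * P = B * (Q * P)" using w by (intro assoc_mult_mat) auto
  also have "\<dots> = B" using w by simp
  also have "mtrace B = sum_list as"
    unfolding diag[symmetric] diag_mat_def mtrace_def
    by (simp add: interv_sum_list_conv_sum_set_nat atLeast0LessThan)
  finally show ?thesis .
qed

section \<open>Construction of an orthonormal eigenbasis\<close>

lemma ip_self_pos:
  assumes "k < d" "v k \<noteq> 0"
  shows "0 < Re (ip d v v)"
proof -
  have "0 < (\<Sum>k<d. (cmod (v k))\<^sup>2)"
    using assms by (intro sum_pos2[of _ k]) auto
  then show ?thesis by (simp add: ip_self)
qed

text \<open>Adding \<open>s\<close> times the projection onto the eigenvectors found so far raises their eigenvalues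
  above the trace of \<open>A\<close>; comparing traces, some eigenvalue of the modified operator is not among
  the raised ones, and its eigenvectors are orthogonal to the old ones.\<close>
lemma psd_next_eigenvector:
  assumes psd: "psd d A" and n: "n < d"
    and orth: "\<And>i j. i < n \<Longrightarrow> j < n \<Longrightarrow> ip d (u i) (u j) = of_bool (i = j)"
    and ev: "\<And>i k. i < n \<Longrightarrow> k < d \<Longrightarrow> app d A (u i) k = of_real (lam i) * u i k"
    and nonneg: "\<And>i. i < n \<Longrightarrow> 0 \<le> lam i"
  obtains w \<theta> where "ip d w w = 1" "\<And>i. i < n \<Longrightarrow> ip d (u i) w = 0"
    "\<And>k. k < d \<Longrightarrow> app d A w k = of_real \<theta> * w k" "0 \<le> \<theta>"
proof -
  note A = psdD(1)[OF psd]
  define s where "s = \<bar>Re (mtrace A)\<bar> + 1"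
  define B where "B = mat d d (\<lambda>(k,l). A $$ (k,l) + of_real s * (\<Sum>i<n. u i k * cnj (u i l)))"
  have B: "B \<in> carrier_mat d d" by (simp add: B_def)
  have appB: "app d B v k = app d A v k + of_real s * (\<Sum>i<n. u i k * ip d (u i) v)" if "k < d" for v k
    using that by (simp add: B_def app_def ip_def sum_distrib_left sum_distrib_right sum.distrib
        algebra_simps sum.swap[of _ "{..<n}"])
  have "mtrace B = mtrace A + of_real s * (\<Sum>i<n. ip d (u i) (u i))"
    using A by (simp add: mtrace_eq[of _ d] B_def sum.distrib sum_distrib_left ip_def
        sum.swap[of _ "{..<n}"] algebra_simps)
  then have trB: "Re (mtrace B) = Re (mtrace A) + s * real n"
    using orth by simp
  obtain as where as: "char_poly B = (\<Prod>a\<leftarrow>as. [:- a, 1:])" "length as = d"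
    using char_poly_factorized[OF B] by auto
  have "\<exists>\<theta>\<in>set as. \<forall>i<n. \<theta> \<noteq> of_real (lam i + s)"
  proof (rule ccontr)
    assume "\<not> ?thesis"
    then have "s \<le> Re \<theta>" if "\<theta> \<in> set as" for \<theta>
      using that nonneg by fastforce
    then have "real (length as) * s \<le> sum_list (map Re as)"
      by (induct as) (auto intro!: add_mono simp: algebra_simps)
    also have "sum_list (map Re as) = Re (mtrace B)"
      unfolding mtrace_eq_sum_roots[OF B as(1)] by (induct as) auto
    \<comment> \<open>With the real parts of all \<open>d\<close> roots at least \<open>s\<close>,
      the trace identity leaves \<open>(d - n) * s \<le> Re (mtrace A) < s\<close>, whereas
      \<open>n < d\<close> makes the left side at least \<open>s\<close>.\<close>
    finally have "(real d - real n) * s < s"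
      by (auto simp: as(2) trB s_def algebra_simps)
    moreover have "1 * s \<le> (real d - real n) * s"
      using n by (intro mult_right_mono) (auto simp: s_def)
    ultimately show False by linarith
  qed
  then obtain \<theta> where \<theta>: "\<theta> \<in> set as" "\<And>i. i < n \<Longrightarrow> \<theta> \<noteq> of_real (lam i + s)" by blast
  have "poly (char_poly B) \<theta> = 0"
    using \<theta>(1) unfolding as(1) poly_prod_list by (simp add: prod_list_zero_iff image_iff)
  then have "eigenvalue B \<theta>" using eigenvalue_root_char_poly[OF B] by simp
  then obtain x where x: "x \<in> carrier_vec d" "x \<noteq> 0\<^sub>v d" "B *\<^sub>v x = \<theta> \<cdot>\<^sub>v x"
    using B by (auto simp: eigenvalue_def eigenvector_def)
  define y where "y = vec_index x"
  have By: "app d B y k = \<theta> * y k" if "k < d" for k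
    using app_mult_mat_vec[OF B x(1) that] x that by (simp add: y_def)
  obtain k where k: "k < d" "y k \<noteq> 0"
    using x(1,2) unfolding y_def by (metis eq_vecI carrier_vecD index_zero_vec)
  define N where "N = Re (ip d y y)"
  have N: "0 < N" "ip d y y = of_real N"
    using ip_self_pos[of k d y] k by (simp_all add: N_def ip_self)
  \<comment> \<open>Each \<open>u i\<close> is an eigenvector of the hermitian \<open>B\<close> with
    eigenvalue \<open>lam i + s\<close>, which differs from \<open>\<theta>\<close>; hence the
    orthogonality.\<close>
  have uy: "ip d (u i) y = 0" if i: "i < n" for i
  proof -
    have "\<theta> * ip d (u i) y = ip d (u i) (app d B y)"
      unfolding ip_scale_right[symmetric] using By by (intro ip_cong) auto
    also have "\<dots> = ip d (u i) (\<lambda>k. app d A y k + of_real s * (\<Sum>j<n. ip d (u j) y * u j k))"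
      using appB by (intro ip_cong) (auto simp: mult.commute)
    also have "\<dots> = ip d (app d A (u i)) y + of_real s * (\<Sum>j<n. ip d (u j) y * ip d (u i) (u j))"
      by (simp add: ip_add_right ip_scale_right ip_sum_right psd_hermitian[OF psd])
    also have "(\<Sum>j<n. ip d (u j) y * ip d (u i) (u j)) = (\<Sum>j<n. if i = j then ip d (u j) y else 0)"
      using i by (intro sum.cong) (auto simp: orth)
    also have "\<dots> = ip d (u i) y"
      using i by (subst sum.delta') auto
    also have "ip d (app d A (u i)) y = ip d (\<lambda>k. of_real (lam i) * u i k) y"
      using ev i by (intro ip_cong) auto
    also have "\<dots> = of_real (lam i) * ip d (u i) y" by (simp add: ip_scale_left)
    finally have "(\<theta> - of_real (lam i + s)) * ip d (u i) y = 0" by (simp add: algebra_simps)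
    then show ?thesis using \<theta>(2)[OF i] by simp
  qed
  \<comment> \<open>Orthogonality switches off the added projection, so \<open>y\<close> is an
    eigenvector of \<open>A\<close> itself.\<close>
  have Ay: "app d A y k = \<theta> * y k" if "k < d" for k
    using By[OF that] appB[OF that, of y] by (simp add: uy)
  have "ip d y (app d A y) = \<theta> * of_real N"
    unfolding N(2)[symmetric] ip_scale_right[symmetric] using Ay by (intro ip_cong) auto
  then have "Im (\<theta> * of_real N) = 0" "0 \<le> Re (\<theta> * of_real N)"
    using psdD(2,3)[OF psd, of y] by simp_all
  then have \<theta>r: "\<theta> = of_real (Re \<theta>)" "0 \<le> Re \<theta>"
    using N(1) by (auto simp: complex_eq_iff zero_le_mult_iff)
  define w where "w = (\<lambda>k. of_real (1 / sqrt N) * y k)"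
  show ?thesis
  proof
    have "1 / sqrt N * (1 / sqrt N) * N = 1" using N(1) by (simp add: field_simps)
    then show "ip d w w = 1"
      unfolding w_def ip_scale_left ip_scale_right N(2)
      by (metis complex_cnj_complex_of_real mult.assoc of_real_1 of_real_mult)
    show "ip d (u i) w = 0" if "i < n" for i
      unfolding w_def ip_scale_right uy[OF that] by simp
    show "app d A w k = of_real (Re \<theta>) * w k" if "k < d" for k
      using Ay[OF that] \<theta>r(1) unfolding w_def app_scale by simp
  qed (rule \<theta>r(2))
qed

text \<open>The second clause is the completeness relation, kept beside orthonormality because
  Parseval's identity and the trace formula use it directly.\<close>

definition eigenbasis :: "nat \<Rightarrow> complex mat \<Rightarrow> (nat \<Rightarrow> nat \<Rightarrow> complex) \<Rightarrow> (nat \<Rightarrow> real) \<Rightarrow> bool" where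
  "eigenbasis d A u lam \<longleftrightarrow>
     (\<forall>i<d. \<forall>j<d. ip d (u i) (u j) = of_bool (i = j)) \<and>
     (\<forall>k<d. \<forall>l<d. (\<Sum>i<d. u i k * cnj (u i l)) = of_bool (k = l)) \<and>
     (\<forall>i<d. \<forall>k<d. app d A (u i) k = of_real (lam i) * u i k) \<and>
     (\<forall>i<d. 0 \<le> lam i)"

lemma psd_orthonormal_eigenvectors:
  assumes psd: "psd d A" and n: "n \<le> d"
  shows "\<exists>u lam. (\<forall>i<n. \<forall>j<n. ip d (u i) (u j) = of_bool (i = j)) \<and>
     (\<forall>i<n. \<forall>k<d. app d A (u i) k = of_real (lam i) * u i k) \<and> (\<forall>i<n. 0 \<le> lam i)"
  using n
proof (induct n)
  case (Suc n)
  then have "n \<le> d" by simp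
  from Suc.hyps[OF this] obtain u lam where IH: "\<And>i j. i < n \<Longrightarrow> j < n \<Longrightarrow> ip d (u i) (u j) = of_bool (i = j)"
    "\<And>i k. i < n \<Longrightarrow> k < d \<Longrightarrow> app d A (u i) k = of_real (lam i) * u i k" "\<And>i. i < n \<Longrightarrow> 0 \<le> lam i"
    by blast
  obtain w \<theta> where w: "ip d w w = 1" "\<And>i. i < n \<Longrightarrow> ip d (u i) w = 0"
    "\<And>k. k < d \<Longrightarrow> app d A w k = of_real \<theta> * w k" "0 \<le> \<theta>"
    by (rule psd_next_eigenvector[where u = u and lam = lam, OF psd Suc_le_lessD[OF Suc.prems]]) (use IH in auto)
  have w': "ip d w (u i) = 0" if "i < n" for i
    using w(2)[OF that] ip_cnj[of d "u i" w] by simp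
  show ?case
    by (rule exI[of _ "u(n := w)"], rule exI[of _ "lam(n := \<theta>)"])
       (use IH w w' in \<open>auto simp: less_Suc_eq\<close>)
qed simp

text \<open>Similarity to a diagonal matrix splits the characteristic polynomial into the linear
  factors of the \<open>lam i\<close>, so the order of a root counts the indices that carry
  it.\<close>

lemma similar_diag_entropy:
  assumes A: "A \<in> carrier_mat d d" and U: "U \<in> carrier_mat d d" "V \<in> carrier_mat d d"
    and UV: "U * V = 1\<^sub>m d" and AU: "A * U = U * mat_diag d (\<lambda>i. complex_of_real (lam i))"
  shows "vn_entropy A = - (\<Sum>i<d. eta (lam i))"
proof -
  let ?D = "mat_diag d (\<lambda>i. complex_of_real (lam i))"
  have D: "?D \<in> carrier_mat d d" by simp
  have VU: "V * U = 1\<^sub>m d" using mat_mult_left_right_inverse[OF U UV] .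
  have "A = A * (U * V)" using A by (simp add: UV)
  also have "\<dots> = U * ?D * V" unfolding AU[symmetric] using A U by (intro assoc_mult_mat[symmetric])
  finally have "similar_mat_wit A ?D U V"
    using A U D UV VU unfolding similar_mat_wit_def Let_def by (metis carrier_matD(1) empty_subsetI insert_subset)
  then have "char_poly A = char_poly ?D"
    by (intro char_poly_similar) (auto simp: similar_mat_def)
  also have "\<dots> = (\<Prod>a\<leftarrow>diag_mat ?D. [:- a, 1:])"
    by (rule char_poly_upper_triangular[OF D]) (auto simp: mat_diag_def)
  also have "diag_mat ?D = map (\<lambda>i. complex_of_real (lam i)) [0..<d]"
    by (auto simp: diag_mat_def mat_diag_def)
  finally have cp: "char_poly A = (\<Prod>i\<leftarrow>[0..<d]. [:- complex_of_real (lam i), 1:])"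
    by (simp add: comp_def)
  have roots: "{l. poly (char_poly A) l = 0} = (\<lambda>i. complex_of_real (lam i)) ` {..<d}"
    unfolding cp poly_prod_list by (auto simp: prod_list_zero_iff)
  have ord: "Polynomial.order l (char_poly A) = (\<Sum>i<d. if of_real (lam i) = l then 1 else 0)" for l
    unfolding cp by (subst order_prod_list)
      (auto simp: comp_def order_linear' interv_sum_list_conv_sum_set_nat atLeast0LessThan intro!: sum.cong)
  let ?R = "(\<lambda>i. complex_of_real (lam i)) ` {..<d}"
  have "(\<Sum>l\<in>?R. real (Polynomial.order l (char_poly A)) * eta (Re l))
      = (\<Sum>l\<in>?R. \<Sum>i<d. if of_real (lam i) = l then eta (lam i) else 0)"
    unfolding ord of_nat_sum sum_distrib_right by (intro sum.cong) auto
  also have "\<dots> = (\<Sum>i<d. \<Sum>l\<in>?R. if of_real (lam i) = l then eta (lam i) else 0)"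
    by (rule sum.swap)
  also have "\<dots> = (\<Sum>i<d. eta (lam i))"
    by (intro sum.cong) (auto simp: sum.delta')
  finally show ?thesis unfolding vn_entropy_def roots by simp
qed

lemma psd_eigenbasis:
  assumes psd: "psd d A"
  obtains u lam where "eigenbasis d A u lam" "vn_entropy A = - (\<Sum>i<d. eta (lam i))"
proof -
  note A = psdD(1)[OF psd]
  obtain u lam where u: "\<And>i j. i < d \<Longrightarrow> j < d \<Longrightarrow> ip d (u i) (u j) = of_bool (i = j)"
     "\<And>i k. i < d \<Longrightarrow> k < d \<Longrightarrow> app d A (u i) k = of_real (lam i) * u i k" "\<And>i. i < d \<Longrightarrow> 0 \<le> lam i"
    using psd_orthonormal_eigenvectors[OF psd order_refl] by blast
  define U where "U = mat d d (\<lambda>(k,i). u i k)"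
  define V where "V = mat d d (\<lambda>(i,k). cnj (u i k))"
  have UV: "U \<in> carrier_mat d d" "V \<in> carrier_mat d d" by (simp_all add: U_def V_def)
  have "V * U = 1\<^sub>m d"
  proof (rule eq_matI)
    fix i j assume "i < dim_row (1\<^sub>m d :: complex mat)" "j < dim_col (1\<^sub>m d :: complex mat)"
    then have ij: "i < d" "j < d" by auto
    then have "(V * U) $$ (i,j) = ip d (u i) (u j)"
      using UV by (subst mult_mat_index[of _ d]) (auto simp: U_def V_def ip_def)
    then show "(V * U) $$ (i,j) = 1\<^sub>m d $$ (i,j)" using ij u(1) by simp
  qed (use UV in auto)
  \<comment> \<open>A left inverse of a square matrix is also a right inverse; this turns
    orthonormality into completeness.\<close>
  then have 1: "U * V = 1\<^sub>m d" using mat_mult_left_right_inverse[OF UV(2,1)] by blast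
  have compl: "(\<Sum>i<d. u i k * cnj (u i l)) = of_bool (k = l)" if "k < d" "l < d" for k l
  proof -
    have "(\<Sum>i<d. u i k * cnj (u i l)) = (U * V) $$ (k,l)"
      using UV that by (subst mult_mat_index[of _ d]) (auto simp: U_def V_def)
    then show ?thesis using that by (simp add: 1)
  qed
  have "A * U = U * mat_diag d (\<lambda>i. complex_of_real (lam i))"
  proof (rule eq_matI)
    fix k i assume "k < dim_row (U * mat_diag d (\<lambda>i. complex_of_real (lam i)))"
      "i < dim_col (U * mat_diag d (\<lambda>i. complex_of_real (lam i)))"
    then have ki: "k < d" "i < d" using UV by (auto simp: mat_diag_def)
    have "(A * U) $$ (k,i) = app d A (u i) k"
      using ki A UV by (subst mult_mat_index[of _ d]) (auto simp: U_def app_def)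
    also have "\<dots> = of_real (lam i) * u i k" using ki u(2) by simp
    also have "\<dots> = (U * mat_diag d (\<lambda>i. complex_of_real (lam i))) $$ (k,i)"
      using ki by (subst mat_diag_mult_right[OF UV(1)]) (auto simp: U_def)
    finally show "(A * U) $$ (k,i) = (U * mat_diag d (\<lambda>i. complex_of_real (lam i))) $$ (k,i)" .
  qed (use A UV in \<open>auto simp: mat_diag_def\<close>)
  from similar_diag_entropy[OF A UV 1 this] show ?thesis
    using that[of u lam] u compl unfolding eigenbasis_def by blast
qed

section \<open>Expansions in an eigenbasis\<close>

lemma eigenbasis_parseval:
  assumes "eigenbasis d A u lam"
  shows "ip d v w = (\<Sum>i<d. ip d v (u i) * ip d (u i) w)"
proof -
  have "(\<Sum>i<d. ip d v (u i) * ip d (u i) w)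
      = (\<Sum>i<d. \<Sum>k<d. \<Sum>l<d. cnj (v k) * (u i k * cnj (u i l)) * w l)"
    unfolding ip_def sum_product by (simp add: algebra_simps)
  also have "\<dots> = (\<Sum>k<d. \<Sum>l<d. \<Sum>i<d. cnj (v k) * (u i k * cnj (u i l)) * w l)"
    by (subst sum.swap, rule sum.cong[OF refl], rule sum.swap)
  also have "\<dots> = (\<Sum>k<d. \<Sum>l<d. cnj (v k) * (\<Sum>i<d. u i k * cnj (u i l)) * w l)"
    by (simp add: sum_distrib_left sum_distrib_right)
  also have "\<dots> = (\<Sum>k<d. \<Sum>l<d. if k = l then cnj (v k) * w l else 0)"
    using assms by (intro sum.cong) (auto simp: eigenbasis_def)
  also have "\<dots> = ip d v w" by (simp add: ip_def)
  finally show ?thesis by simp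
qed

lemma eigenbasis_parseval_norm:
  assumes "eigenbasis d A u lam"
  shows "Re (ip d v v) = (\<Sum>i<d. (cmod (ip d (u i) v))\<^sup>2)"
proof -
  have "ip d v (u i) * ip d (u i) v = of_real ((cmod (ip d (u i) v))\<^sup>2)" for i
    unfolding complex_norm_square ip_cnj by (rule mult.commute)
  then show ?thesis unfolding eigenbasis_parseval[OF assms, of v v] by simp
qed

lemma eigenbasis_mtrace:
  assumes "eigenbasis d A u lam" and M: "M \<in> carrier_mat d d"
  shows "mtrace M = (\<Sum>i<d. ip d (u i) (app d M (u i)))"
proof -
  have "(\<Sum>i<d. ip d (u i) (app d M (u i))) = (\<Sum>i<d. \<Sum>k<d. \<Sum>l<d. M $$ (k,l) * (u i l * cnj (u i k)))"
    by (simp add: ip_def app_def sum_distrib_left algebra_simps)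
  also have "\<dots> = (\<Sum>k<d. \<Sum>l<d. \<Sum>i<d. M $$ (k,l) * (u i l * cnj (u i k)))"
    by (subst sum.swap, rule sum.cong[OF refl], rule sum.swap)
  also have "\<dots> = (\<Sum>k<d. \<Sum>l<d. M $$ (k,l) * (\<Sum>i<d. u i l * cnj (u i k)))"
    by (simp add: sum_distrib_left)
  also have "\<dots> = (\<Sum>k<d. \<Sum>l<d. if k = l then M $$ (k,l) else 0)"
    using assms by (intro sum.cong) (auto simp: eigenbasis_def)
  also have "\<dots> = mtrace M" using M by (simp add: mtrace_eq)
  finally show ?thesis by simp
qed

lemma eigenbasis_app:
  assumes "eigenbasis d A u lam" "i < d"
  shows "ip d v (app d A (u i)) = of_real (lam i) * ip d v (u i)"
  unfolding ip_scale_right[symmetric] using assms by (intro ip_cong) (auto simp: eigenbasis_def)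

lemma eigenbasis_self: "eigenbasis d A u lam \<Longrightarrow> i < d \<Longrightarrow> ip d (u i) (u i) = 1"
  by (simp add: eigenbasis_def)

lemma eigenbasis_form:
  assumes eb: "eigenbasis d A u lam" and psd: "psd d A"
  shows "Re (ip d v (app d A v)) = (\<Sum>i<d. lam i * (cmod (ip d (u i) v))\<^sup>2)"
proof -
  have "ip d v (app d A v) = (\<Sum>i<d. ip d v (u i) * ip d (u i) (app d A v))"
    by (rule eigenbasis_parseval[OF eb])
  also have "\<dots> = (\<Sum>i<d. of_real (lam i * (cmod (ip d (u i) v))\<^sup>2))"
  proof (rule sum.cong)
    fix i assume i: "i \<in> {..<d}"
    have "ip d (u i) (app d A v) = cnj (ip d v (app d A (u i)))"
      by (simp add: ip_cnj psd_hermitian[OF psd])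
    also have "\<dots> = of_real (lam i) * ip d (u i) v"
      using i by (simp add: eigenbasis_app[OF eb] ip_cnj)
    finally show "ip d v (u i) * ip d (u i) (app d A v) = of_real (lam i * (cmod (ip d (u i) v))\<^sup>2)"
      unfolding of_real_mult complex_norm_square ip_cnj by simp
  qed simp
  finally show ?thesis by simp
qed

lemma app_mult:
  assumes "A \<in> carrier_mat d d" "B \<in> carrier_mat d d" "k < d"
  shows "app d (A * B) v k = app d A (app d B v) k"
proof -
  have "app d (A * B) v k = (\<Sum>l<d. \<Sum>m<d. A $$ (k,m) * B $$ (m,l) * v l)"
    using assms by (simp add: app_def mult_mat_index sum_distrib_right del: index_mult_mat)
  also have "\<dots> = app d A (app d B v) k"
    by (subst sum.swap) (simp add: app_def sum_distrib_left mult.assoc)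
  finally show ?thesis .
qed

lemma eigenbasis_mtrace_mult:
  assumes eb: "eigenbasis d A u lam" and psd: "psd d A" and M: "M \<in> carrier_mat d d"
  shows "mtrace (A * M) = (\<Sum>i<d. of_real (lam i) * ip d (u i) (app d M (u i)))"
proof -
  note A = psdD(1)[OF psd]
  have "mtrace (A * M) = (\<Sum>i<d. ip d (u i) (app d (A * M) (u i)))"
    using A M by (intro eigenbasis_mtrace[OF eb]) auto
  also have "\<dots> = (\<Sum>i<d. of_real (lam i) * ip d (u i) (app d M (u i)))"
  proof (rule sum.cong)
    fix i assume i: "i \<in> {..<d}"
    have "ip d (u i) (app d (A * M) (u i)) = ip d (u i) (app d A (app d M (u i)))"
      using app_mult[OF A M] by (intro ip_cong) auto
    also have "\<dots> = cnj (ip d (app d M (u i)) (app d A (u i)))"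
      by (simp add: ip_cnj psd_hermitian[OF psd])
    also have "\<dots> = of_real (lam i) * ip d (u i) (app d M (u i))"
      using i by (simp add: eigenbasis_app[OF eb] ip_cnj)
    finally show "ip d (u i) (app d (A * M) (u i)) = of_real (lam i) * ip d (u i) (app d M (u i))" .
  qed simp
  finally show ?thesis .
qed

lemma eigenbasis_sum_eigenvalues:
  assumes eb: "eigenbasis d A u lam" and "A \<in> carrier_mat d d"
  shows "(\<Sum>i<d. lam i) = Re (mtrace A)"
  by (simp add: eigenbasis_mtrace[OF assms] eigenbasis_app[OF eb] eigenbasis_self[OF eb])

section \<open>Relative entropy and measurements\<close>

text \<open>The function \<open>G\<close> is nondecreasing, its derivative being the difference of
  the resolvent sums, and tends to 0 at infinity because the masses agree; hence
  \<open>G 0 \<le> 0\<close>. This takes the place of the integral representation of the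
  logarithm.\<close>

lemma sum_log_le_if_resolvent_le:
  fixes c x :: "'a \<Rightarrow> real" and e z :: "'b \<Rightarrow> real"
  assumes mass: "sum c K = sum e L"
    and x: "\<And>k. k \<in> K \<Longrightarrow> 0 < x k" and z: "\<And>l. l \<in> L \<Longrightarrow> 0 < z l"
    and le: "\<And>t. 0 \<le> t \<Longrightarrow> (\<Sum>l\<in>L. e l / (z l + t)) \<le> (\<Sum>k\<in>K. c k / (x k + t))"
  shows "(\<Sum>k\<in>K. c k * log 2 (x k)) \<le> (\<Sum>l\<in>L. e l * log 2 (z l))"
proof -
  define G where "G t = (\<Sum>k\<in>K. c k * ln (x k + t)) - (\<Sum>l\<in>L. e l * ln (z l + t))" for t
  have mono: "G 0 \<le> G t" if "0 \<le> t" for t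
  proof (rule DERIV_nonneg_imp_nondecreasing[OF that])
    fix s :: real assume s: "0 \<le> s" "s \<le> t"
    have "(G has_real_derivative (\<Sum>k\<in>K. c k / (x k + s)) - (\<Sum>l\<in>L. e l / (z l + s))) (at s)"
      unfolding G_def using s x z
      by (auto intro!: derivative_eq_intros sum.cong simp: add_pos_nonneg)
    then show "\<exists>y. (G has_real_derivative y) (at s) \<and> 0 \<le> y"
      using le[OF s(1)] by (intro exI conjI) auto
  qed
  have lim: "((\<lambda>t. ln (a + t) - ln t) \<longlongrightarrow> 0) at_top" for a :: real
    by real_asymp
  \<comment> \<open>Equal masses allow \<open>ln t\<close> to be subtracted from every logarithm,
    after which each term tends to 0.\<close>
  have "((\<lambda>t. (\<Sum>k\<in>K. c k * (ln (x k + t) - ln t)) - (\<Sum>l\<in>L. e l * (ln (z l + t) - ln t)))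
      \<longlongrightarrow> (\<Sum>k\<in>K. c k * 0) - (\<Sum>l\<in>L. e l * 0)) at_top"
    by (intro tendsto_diff tendsto_sum tendsto_mult tendsto_const lim)
  also have "(\<lambda>t. (\<Sum>k\<in>K. c k * (ln (x k + t) - ln t)) - (\<Sum>l\<in>L. e l * (ln (z l + t) - ln t))) = G"
    unfolding G_def right_diff_distrib sum_subtractf sum_distrib_right[symmetric] mass by (simp add: fun_eq_iff)
  finally have "(G \<longlongrightarrow> 0) at_top" by simp
  then have "G 0 \<le> 0"
    by (rule tendsto_lowerbound) (use mono in \<open>auto simp: eventually_at_top_linorder intro: exI[of _ 0]\<close>)
  then have "(\<Sum>k\<in>K. c k * ln (x k)) / ln 2 \<le> (\<Sum>l\<in>L. e l * ln (z l)) / ln 2"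
    by (intro divide_right_mono) (auto simp: G_def)
  then show ?thesis by (simp add: log_def sum_divide_distrib)
qed

section \<open>Operator domination and traces against effects\<close>

lemma cmod_ip_commute: "cmod (ip d v w) = cmod (ip d w v)"
  by (metis complex_mod_cnj ip_cnj)

lemma app_smult_minus:
  assumes "A \<in> carrier_mat d d" "B \<in> carrier_mat d d" "k < d"
  shows "app d (c \<cdot>\<^sub>m A - B) v k = c * app d A v k - app d B v k"
  using assms by (simp add: app_def sum_subtractf sum_distrib_left algebra_simps)

lemma psd_diff_form_le:
  assumes "psd d (complex_of_real m \<cdot>\<^sub>m \<sigma> - \<rho>)" "\<sigma> \<in> carrier_mat d d" "\<rho> \<in> carrier_mat d d"
  shows "Re (ip d w (app d \<rho> w)) \<le> m * Re (ip d w (app d \<sigma> w))"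
proof -
  have "ip d w (app d (complex_of_real m \<cdot>\<^sub>m \<sigma> - \<rho>) w)
      = ip d w (\<lambda>k. complex_of_real m * app d \<sigma> w k - app d \<rho> w k)"
    using assms(2,3) by (intro ip_cong) (auto simp: app_smult_minus)
  then show ?thesis
    using psdD(3)[OF assms(1), of w] by (simp add: ip_diff_right ip_scale_right)
qed

text \<open>Diagonalising the effect \<open>F\<close> rather than \<open>A\<close> turns the trace
  into a nonnegative combination of values of the form of \<open>A\<close>, so inequalities between
  forms pass to outcome probabilities.\<close>

lemma psd_mtrace_mult:
  assumes "psd d F" "eigenbasis d F w f" "A \<in> carrier_mat d d"
  shows "Re (mtrace (A * F)) = (\<Sum>i<d. f i * Re (ip d (w i) (app d A (w i))))"
  using eigenbasis_mtrace_mult[OF assms(2,1,3)] psdD(1)[OF assms(1)]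
  by (simp add: mtrace_mult_commute[OF assms(3)])

lemma psd_mtrace_mult_nonneg:
  assumes "psd d A" "psd d F"
  shows "0 \<le> Re (mtrace (A * F))"
proof -
  obtain w f where w: "eigenbasis d F w f" using psd_eigenbasis[OF assms(2)] by blast
  then have "0 \<le> f i" if "i < d" for i using that by (simp add: eigenbasis_def)
  then show ?thesis
    unfolding psd_mtrace_mult[OF assms(2) w psdD(1)[OF assms(1)]]
    by (intro sum_nonneg mult_nonneg_nonneg psdD(3)[OF assms(1)]) auto
qed

lemma psd_diff_mtrace_mult_le:
  assumes m: "psd d (complex_of_real m \<cdot>\<^sub>m \<sigma> - \<rho>)" "\<sigma> \<in> carrier_mat d d" "\<rho> \<in> carrier_mat d d" and F: "psd d F"
  shows "Re (mtrace (\<rho> * F)) \<le> m * Re (mtrace (\<sigma> * F))"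
proof -
  obtain w f where w: "eigenbasis d F w f" using psd_eigenbasis[OF F] by blast
  have f: "0 \<le> f i" if "i < d" for i using that w by (simp add: eigenbasis_def)
  have "Re (mtrace (\<rho> * F)) \<le> (\<Sum>i<d. f i * (m * Re (ip d (w i) (app d \<sigma> (w i)))))"
    unfolding psd_mtrace_mult[OF F w m(3)]
    by (intro sum_mono mult_left_mono psd_diff_form_le[OF m] f) auto
  also have "\<dots> = m * Re (mtrace (\<sigma> * F))"
    unfolding psd_mtrace_mult[OF F w m(2)] by (simp add: sum_distrib_left algebra_simps)
  finally show ?thesis .
qed

section \<open>Measurements\<close>

lemma povm_app:
  assumes "povm d Y F" "k < d"
  shows "(\<Sum>y\<in>Y. app d (F y) v k) = v k"
proof -
  have "(\<Sum>y\<in>Y. app d (F y) v k) = (\<Sum>l<d. (\<Sum>y\<in>Y. F y $$ (k,l)) * v l)"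
    by (simp add: app_def sum_distrib_right sum.swap[of _ Y])
  also have "\<dots> = (\<Sum>l<d. msum d Y F $$ (k,l) * v l)"
    using assms(2) by (simp add: msum_def)
  also have "\<dots> = (\<Sum>l<d. if k = l then v l else 0)"
    using assms by (intro sum.cong) (auto simp: povm_def)
  finally show ?thesis using assms(2) by simp
qed

text \<open>Kadison's inequality for the square function and the positive unital map \<open>a \<mapsto> \<Sum>y. a y F y\<close>.\<close>
lemma povm_norm_le:
  fixes a :: "nat \<Rightarrow> real"
  assumes povm: "povm d Y F"
  defines "X \<equiv> \<lambda>v k. \<Sum>y\<in>Y. of_real (a y) * app d (F y) v k"
  shows "Re (ip d (X v) (X v)) \<le> (\<Sum>y\<in>Y. (a y)\<^sup>2 * Re (ip d v (app d (F y) v)))"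
proof -
  have psd: "psd d (F y)" if "y \<in> Y" for y using povm that by (simp add: povm_def)
  have Xv: "(\<Sum>y\<in>Y. of_real (a y) * ip d (X v) (app d (F y) v)) = ip d (X v) (X v)"
    by (simp add: X_def ip_sum_right ip_scale_right)
  have "(\<Sum>y\<in>Y. ip d (X v) (app d (F y) (X v))) = ip d (X v) (\<lambda>k. \<Sum>y\<in>Y. app d (F y) (X v) k)"
    by (simp add: ip_sum_right)
  also have "\<dots> = ip d (X v) (X v)"
    using povm_app[OF povm] by (intro ip_cong) auto
  finally have XX: "(\<Sum>y\<in>Y. ip d (X v) (app d (F y) (X v))) = ip d (X v) (X v)" .
  \<comment> \<open>A variance: each \<open>F y\<close> is evaluated at \<open>a y\<close> times
    \<open>v\<close> minus the mean \<open>X v\<close>. As the \<open>F y\<close> sum to the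
    identity, the expansion is the claimed bound minus the squared norm of
    \<open>X v\<close>.\<close>
  have "0 \<le> (\<Sum>y\<in>Y. Re (ip d (\<lambda>k. of_real (a y) * v k - X v k) (app d (F y) (\<lambda>k. of_real (a y) * v k - X v k))))"
    using psd by (intro sum_nonneg psdD(3)) auto
  also have "\<dots> = (\<Sum>y\<in>Y. (a y)\<^sup>2 * Re (ip d v (app d (F y) v))
      - 2 * Re (of_real (a y) * ip d (X v) (app d (F y) v)) + Re (ip d (X v) (app d (F y) (X v))))"
  proof (rule sum.cong)
    fix y assume y: "y \<in> Y"
    have "ip d v (app d (F y) (X v)) = cnj (ip d (X v) (app d (F y) v))"
      by (simp add: ip_cnj psd_hermitian[OF psd[OF y]])
    then show "Re (ip d (\<lambda>k. of_real (a y) * v k - X v k) (app d (F y) (\<lambda>k. of_real (a y) * v k - X v k)))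
      = (a y)\<^sup>2 * Re (ip d v (app d (F y) v))
      - 2 * Re (of_real (a y) * ip d (X v) (app d (F y) v)) + Re (ip d (X v) (app d (F y) (X v)))"
      by (simp add: app_diff app_scale ip_diff_left ip_diff_right ip_scale_left ip_scale_right
          power2_eq_square)
  qed simp
  also have "\<dots> = (\<Sum>y\<in>Y. (a y)\<^sup>2 * Re (ip d v (app d (F y) v)))
      - 2 * Re (\<Sum>y\<in>Y. of_real (a y) * ip d (X v) (app d (F y) v)) + Re (\<Sum>y\<in>Y. ip d (X v) (app d (F y) (X v)))"
    by (simp only: sum.distrib sum_subtractf sum_distrib_left Re_sum)
  finally show ?thesis unfolding Xv XX by simp
qed

lemma povm_sum_mtrace:
  assumes "povm d Y F" "eigenbasis d A u lam" "psd d A"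
  shows "(\<Sum>y\<in>Y. b y * Re (mtrace (A * F y)))
    = (\<Sum>i<d. lam i * (\<Sum>y\<in>Y. b y * Re (ip d (u i) (app d (F y) (u i)))))"
proof -
  have "Re (mtrace (A * F y)) = (\<Sum>i<d. lam i * Re (ip d (u i) (app d (F y) (u i))))" if "y \<in> Y" for y
    using assms that by (subst eigenbasis_mtrace_mult[OF assms(2,3)]) (auto simp: povm_def intro: psdD(1))
  then show ?thesis
    by (simp add: sum_distrib_left sum.swap[of _ Y] algebra_simps)
qed

section \<open>Relative entropy of a dominated pair\<close>

locale dominated_pair =
  fixes d :: nat and \<rho> \<sigma> :: "complex mat" and u v :: "nat \<Rightarrow> nat \<Rightarrow> complex"
    and lam mu :: "nat \<Rightarrow> real" and m :: real
  assumes \<rho>: "psd d \<rho>" and tr\<rho>: "mtrace \<rho> = 1" and \<sigma>: "psd d \<sigma>"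
    and u: "eigenbasis d \<rho> u lam" and v: "eigenbasis d \<sigma> v mu"
    and dom: "psd d (complex_of_real m \<cdot>\<^sub>m \<sigma> - \<rho>)"
begin

text \<open>The products \<open>lam i * P i j\<close> and \<open>mu j * P i j\<close> are the
  Nussbaum-Szkola distributions on index pairs, whose classical relative entropy is the quantum
  one.\<close>

definition P :: "nat \<Rightarrow> nat \<Rightarrow> real" where
  "P i j = (cmod (ip d (v j) (u i)))\<^sup>2"

text \<open>The support of the first distribution. On it \<open>lam i\<close>, \<open>P i j\<close>
  and \<open>mu j\<close> are all positive, so the quotients and logarithms below carry no default
  values.\<close>

definition K :: "(nat \<times> nat) set" where
  "K = {(i,j). i < d \<and> j < d \<and> 0 < lam i * P i j}"

lemma lam_nonneg: "i < d \<Longrightarrow> 0 \<le> lam i" using u by (simp add: eigenbasis_def)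
lemma mu_nonneg: "i < d \<Longrightarrow> 0 \<le> mu i" using v by (simp add: eigenbasis_def)
lemma P_nonneg: "0 \<le> P i j" by (simp add: P_def)

lemma sum_P: "i < d \<Longrightarrow> (\<Sum>j<d. P i j) = 1"
  using eigenbasis_parseval_norm[OF v, of "u i"] eigenbasis_self[OF u, of i] by (simp add: P_def)

lemma sum_lam_P: "(\<Sum>i<d. lam i * P i j) = Re (ip d (v j) (app d \<rho> (v j)))"
  by (simp add: eigenbasis_form[OF u \<rho>] P_def cmod_ip_commute)

lemma sum_lam: "(\<Sum>i<d. lam i) = 1"
  using eigenbasis_sum_eigenvalues[OF u psdD(1)[OF \<rho>]] tr\<rho> by simp

text \<open>Positivity of \<open>mu j\<close> is the support condition: the form of
  \<open>\<rho>\<close> at \<open>v j\<close> is positive and, by domination, at most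
  \<open>m * mu j\<close>.\<close>

lemma K_pos:
  assumes "(i,j) \<in> K"
  shows "0 < lam i" "0 < P i j" "0 < mu j"
proof -
  have ij: "i < d" "j < d" "0 < lam i * P i j" using assms by (auto simp: K_def)
  then show "0 < lam i" "0 < P i j"
    using lam_nonneg[OF ij(1)] P_nonneg[of i j] by (auto simp: zero_less_mult_iff)
  have "0 < (\<Sum>i<d. lam i * P i j)"
    using ij lam_nonneg P_nonneg by (intro sum_pos2[of _ i]) auto
  also have "\<dots> \<le> m * Re (ip d (v j) (app d \<sigma> (v j)))"
    unfolding sum_lam_P by (rule psd_diff_form_le[OF dom psdD(1)[OF \<sigma>] psdD(1)[OF \<rho>]])
  also have "\<dots> = m * mu j"
    using ij by (simp add: eigenbasis_app[OF v] eigenbasis_self[OF v])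
  finally show "0 < mu j" using mu_nonneg[OF ij(2)] by (auto simp: zero_less_mult_iff)
qed

lemma sum_K:
  assumes "\<And>i j. i < d \<Longrightarrow> j < d \<Longrightarrow> lam i * P i j = 0 \<Longrightarrow> g i j = 0"
  shows "(\<Sum>(i,j)\<in>K. g i j) = (\<Sum>i<d. \<Sum>j<d. g i j)"
proof -
  have "(\<Sum>(i,j)\<in>K. g i j) = (\<Sum>(i,j)\<in>{..<d} \<times> {..<d}. g i j)"
  proof (rule sum.mono_neutral_left)
    show "\<forall>x\<in>{..<d} \<times> {..<d} - K. (case x of (i, j) \<Rightarrow> g i j) = 0"
    proof clarsimp
      fix i j assume "i < d" "j < d" "(i,j) \<notin> K"
      moreover from this have "0 \<le> lam i * P i j" by (simp add: lam_nonneg P_nonneg)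
      ultimately show "g i j = 0" using assms[of i j] by (auto simp: K_def)
    qed
  qed (auto simp: K_def)
  then show ?thesis by (simp add: sum.cartesian_product)
qed

lemma sum_K_mass: "(\<Sum>(i,j)\<in>K. lam i * P i j) = 1"
  by (subst sum_K) (simp_all add: sum_distrib_left[symmetric] sum_P sum_lam)

text \<open>After splitting the logarithm, summing over \<open>j\<close> first yields the entropy
  part by \<open>sum_P\<close>, and summing over \<open>i\<close> first yields the cross term by
  \<open>sum_lam_P\<close>.\<close>

lemma relative_entropy_eq:
  "(\<Sum>i<d. eta (lam i)) - (\<Sum>j<d. log 2 (mu j) * Re (ip d (v j) (app d \<rho> (v j))))
    = - (\<Sum>(i,j)\<in>K. lam i * P i j * log 2 (mu j / lam i))"
proof -
  have "(\<Sum>(i,j)\<in>K. lam i * P i j * log 2 (mu j / lam i))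
      = (\<Sum>(i,j)\<in>K. log 2 (mu j) * (lam i * P i j) - lam i * log 2 (lam i) * P i j)"
  proof (rule sum.cong)
    fix x assume "x \<in> K"
    then show "(case x of (i, j) \<Rightarrow> lam i * P i j * log 2 (mu j / lam i))
      = (case x of (i, j) \<Rightarrow> log 2 (mu j) * (lam i * P i j) - lam i * log 2 (lam i) * P i j)"
      using K_pos[of "fst x" "snd x"] by (cases x) (auto simp: log_divide algebra_simps)
  qed simp
  also have "\<dots> = (\<Sum>i<d. \<Sum>j<d. log 2 (mu j) * (lam i * P i j) - lam i * log 2 (lam i) * P i j)"
    by (rule sum_K) auto
  also have "\<dots> = (\<Sum>i<d. \<Sum>j<d. log 2 (mu j) * (lam i * P i j)) - (\<Sum>i<d. lam i * log 2 (lam i) * (\<Sum>j<d. P i j))"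
    by (simp add: sum_subtractf sum_distrib_left)
  also have "(\<Sum>i<d. \<Sum>j<d. log 2 (mu j) * (lam i * P i j)) = (\<Sum>j<d. log 2 (mu j) * (\<Sum>i<d. lam i * P i j))"
    by (subst sum.swap) (simp add: sum_distrib_left)
  also have "(\<Sum>i<d. lam i * log 2 (lam i) * (\<Sum>j<d. P i j)) = (\<Sum>i<d. eta (lam i))"
    using lam_nonneg by (intro sum.cong) (auto simp: sum_P eta_def dest: antisym)
  finally show ?thesis by (simp add: sum_lam_P)
qed

lemma m_pos: "0 < m"
proof -
  have "1 = (\<Sum>i<d. Re (ip d (u i) (app d \<rho> (u i))))"
    by (simp add: eigenbasis_app[OF u] eigenbasis_self[OF u] sum_lam)
  also have "\<dots> \<le> (\<Sum>i<d. m * Re (ip d (u i) (app d \<sigma> (u i))))"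
    by (intro sum_mono psd_diff_form_le[OF dom psdD(1)[OF \<sigma>] psdD(1)[OF \<rho>]])
  also have "\<dots> = m * (\<Sum>i<d. Re (ip d (u i) (app d \<sigma> (u i))))" by (simp add: sum_distrib_left)
  finally have "0 < m * (\<Sum>i<d. Re (ip d (u i) (app d \<sigma> (u i))))" by simp
  moreover have "0 \<le> (\<Sum>i<d. Re (ip d (u i) (app d \<sigma> (u i))))"
    by (intro sum_nonneg psdD(3)[OF \<sigma>])
  ultimately show ?thesis by (auto simp: zero_less_mult_iff)
qed

text \<open>The left side is the trace of \<open>\<rho>\<^sup>2 \<sigma>\<^sup>-\<^sup>1\<close>. With \<open>X = \<sigma>\<^sup>-\<^sup>1 \<rho>\<close> and \<open>S = tr (\<rho> X) = tr (X\<^sup>* \<sigma> X)\<close>,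
  domination and Cauchy-Schwarz give \<open>m S \<ge> tr (X\<^sup>* \<rho> X) \<ge> S\<^sup>2\<close>. The vectors \<open>w i\<close> are \<open>X (u i)\<close>.\<close>
lemma sum_K_ratio_le: "(\<Sum>(i,j)\<in>K. lam i * P i j * (lam i / mu j)) \<le> m"
proof -
  \<comment> \<open>Where \<open>mu j = 0\<close> the quotient is 0 by convention, so the inverse of
    \<open>\<sigma>\<close> is in effect its pseudo-inverse.\<close>
  define S where "S = (\<Sum>i<d. \<Sum>j<d. lam i * P i j * (lam i / mu j))"
  define w where "w i = (\<lambda>k. \<Sum>j<d. (of_real (lam i / mu j) * ip d (v j) (u i)) * v j k)" for i
  have vw: "ip d (v j) (w i) = of_real (lam i / mu j) * ip d (v j) (u i)" if "j < d" for i j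
  proof -
    have "ip d (v j) (w i) = (\<Sum>j'<d. (of_real (lam i / mu j') * ip d (v j') (u i)) * ip d (v j) (v j'))"
      unfolding w_def ip_sum_right ip_scale_right ..
    also have "\<dots> = (\<Sum>j'<d. if j = j' then of_real (lam i / mu j') * ip d (v j') (u i) else 0)"
      using v that by (intro sum.cong) (auto simp: eigenbasis_def)
    finally show ?thesis using that by simp
  qed
  have w\<sigma>: "Re (ip d (w i) (app d \<sigma> (w i))) = (\<Sum>j<d. lam i * P i j * (lam i / mu j))" for i
    unfolding eigenbasis_form[OF v \<sigma>]
    by (intro sum.cong) (auto simp: vw norm_mult norm_divide P_def power2_eq_square field_simps)
  have wu: "ip d (w i) (app d \<rho> (u i)) = of_real (\<Sum>j<d. lam i * P i j * (lam i / mu j))" if "i < d" for i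
  proof -
    have "ip d (w i) (u i) = (\<Sum>j<d. ip d (w i) (v j) * ip d (v j) (u i))"
      by (rule eigenbasis_parseval[OF v])
    also have "\<dots> = (\<Sum>j<d. of_real (P i j * (lam i / mu j)))"
    proof (rule sum.cong)
      fix j assume "j \<in> {..<d}"
      then have "ip d (w i) (v j) = of_real (lam i / mu j) * cnj (ip d (v j) (u i))"
        unfolding ip_cnj[of d "v j" "w i", symmetric] by (simp add: vw)
      then show "ip d (w i) (v j) * ip d (v j) (u i) = of_real (P i j * (lam i / mu j))"
        unfolding P_def of_real_mult complex_norm_square by simp
    qed simp
    finally show ?thesis
      using that by (simp add: eigenbasis_app[OF u] sum_distrib_left mult.assoc)
  qed
  \<comment> \<open>Cauchy-Schwarz as a nonnegative square; the multiplier \<open>S\<close> is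
    optimal because \<open>\<rho>\<close> has trace 1.\<close>
  have "0 \<le> (\<Sum>i<d. Re (ip d (\<lambda>k. w i k - of_real S * u i k) (app d \<rho> (\<lambda>k. w i k - of_real S * u i k))))"
    by (intro sum_nonneg psdD(3)[OF \<rho>])
  also have "\<dots> = (\<Sum>i<d. Re (ip d (w i) (app d \<rho> (w i)))
      - 2 * S * (\<Sum>j<d. lam i * P i j * (lam i / mu j)) + S\<^sup>2 * lam i)"
  proof (rule sum.cong)
    fix i assume "i \<in> {..<d}"
    then have i: "i < d" by simp
    have "ip d (u i) (app d \<rho> (w i)) = cnj (ip d (w i) (app d \<rho> (u i)))"
      by (simp add: ip_cnj psd_hermitian[OF \<rho>])
    moreover have "ip d (u i) (app d \<rho> (u i)) = of_real (lam i)"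
      using i by (simp add: eigenbasis_app[OF u] eigenbasis_self[OF u])
    ultimately show "Re (ip d (\<lambda>k. w i k - of_real S * u i k) (app d \<rho> (\<lambda>k. w i k - of_real S * u i k)))
      = Re (ip d (w i) (app d \<rho> (w i))) - 2 * S * (\<Sum>j<d. lam i * P i j * (lam i / mu j)) + S\<^sup>2 * lam i"
      unfolding app_diff app_scale ip_diff_left ip_diff_right ip_scale_left ip_scale_right wu[OF i]
      by (simp add: power2_eq_square)
  qed simp
  also have "\<dots> = (\<Sum>i<d. Re (ip d (w i) (app d \<rho> (w i)))) - 2 * S * S + S\<^sup>2"
    by (simp add: sum.distrib sum_subtractf sum_distrib_left[symmetric] sum_lam S_def)
  also have "(\<Sum>i<d. Re (ip d (w i) (app d \<rho> (w i)))) \<le> (\<Sum>i<d. m * Re (ip d (w i) (app d \<sigma> (w i))))"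
    by (intro sum_mono psd_diff_form_le[OF dom psdD(1)[OF \<sigma>] psdD(1)[OF \<rho>]])
  also have "\<dots> = m * S" by (simp add: w\<sigma> S_def sum_distrib_left)
  finally have "S * S \<le> m * S" by (simp add: power2_eq_square)
  then have "S \<le> m"
    using m_pos by (cases "0 < S") (auto simp: mult_le_cancel_right)
  also have "S = (\<Sum>(i,j)\<in>K. lam i * P i j * (lam i / mu j))"
    unfolding S_def by (subst sum_K) auto
  finally show ?thesis .
qed

text \<open>Jensen's inequality in tangent form: \<open>ln x \<le> x - 1\<close> at
  \<open>x = lam i / mu j / m\<close>. After averaging, \<open>sum_K_ratio_le\<close> makes the
  linear term at most the constant \<open>1 / ln 2\<close> that was subtracted.\<close>

lemma relative_entropy_le_log:
  "(\<Sum>i<d. eta (lam i)) - (\<Sum>j<d. log 2 (mu j) * Re (ip d (v j) (app d \<rho> (v j)))) \<le> log 2 m"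
proof -
  have "- (\<Sum>(i,j)\<in>K. lam i * P i j * log 2 (mu j / lam i)) = (\<Sum>(i,j)\<in>K. lam i * P i j * - log 2 (mu j / lam i))"
    by (simp add: sum_negf case_prod_unfold)
  also have "\<dots> \<le> (\<Sum>(i,j)\<in>K. lam i * P i j * (log 2 m + (lam i / mu j / m - 1) / ln 2))"
  proof (rule sum_mono)
    fix x assume x: "x \<in> K"
    obtain i j where ij: "x = (i,j)" by (cases x)
    note pos = K_pos[OF x[unfolded ij]] m_pos
    have "ln (lam i / mu j / m) \<le> lam i / mu j / m - 1"
      using pos by (intro ln_le_minus_one) auto
    then have "- ln (mu j / lam i) \<le> ln m + (lam i / mu j / m - 1)"
      using pos by (simp add: ln_div ln_mult)
    then have "- ln (mu j / lam i) / ln 2 \<le> (ln m + (lam i / mu j / m - 1)) / ln 2"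
      by (intro divide_right_mono) auto
    then have "- log 2 (mu j / lam i) \<le> log 2 m + (lam i / mu j / m - 1) / ln 2"
      by (simp add: log_def add_divide_distrib)
    then show "(case x of (i, j) \<Rightarrow> lam i * P i j * - log 2 (mu j / lam i))
      \<le> (case x of (i, j) \<Rightarrow> lam i * P i j * (log 2 m + (lam i / mu j / m - 1) / ln 2))"
      using pos unfolding ij prod.case by (intro mult_left_mono) auto
  qed
  also have "\<dots> = (\<Sum>(i,j)\<in>K. lam i * P i j * (log 2 m - 1 / ln 2) + lam i * P i j * (lam i / mu j) * (1 / (m * ln 2)))"
    using m_pos by (intro sum.cong) (auto simp: field_simps)
  also have "\<dots> = (\<Sum>(i,j)\<in>K. lam i * P i j) * (log 2 m - 1 / ln 2)
      + (\<Sum>(i,j)\<in>K. lam i * P i j * (lam i / mu j)) * (1 / (m * ln 2))"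
    by (simp only: case_prod_unfold sum.distrib sum_distrib_right)
  also have "\<dots> \<le> (log 2 m - 1 / ln 2) + m * (1 / (m * ln 2))"
    unfolding sum_K_mass using m_pos by (intro add_mono mult_right_mono sum_K_ratio_le) auto
  also have "\<dots> = log 2 m" using m_pos by simp
  finally show ?thesis unfolding relative_entropy_eq .
qed

text \<open>The left side is a concave functional of the weights \<open>a y\<close>. Kadison's
  inequality replaces squared weights by squares of \<open>X\<close>; expanding in the two
  eigenbases and completing the square in each matrix element give the right side.\<close>

lemma povm_resolvent_le:
  assumes povm: "povm d Y F" and t: "0 \<le> t"
  defines "q \<equiv> \<lambda>y. Re (mtrace (\<rho> * F y))" and "r \<equiv> \<lambda>y. Re (mtrace (\<sigma> * F y))"
  shows "(\<Sum>y\<in>{y\<in>Y. 0 < q y}. q y / (r y / q y + t)) \<le> (\<Sum>(i,j)\<in>K. lam i * P i j / (mu j / lam i + t))"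
proof -
  have fin: "finite Y" and F: "\<And>y. y \<in> Y \<Longrightarrow> psd d (F y)" using povm by (auto simp: povm_def)
  have q: "0 \<le> q y" "0 \<le> r y" "q y \<le> m * r y" if "y \<in> Y" for y
    using psd_mtrace_mult_nonneg[OF \<rho> F[OF that]] psd_mtrace_mult_nonneg[OF \<sigma> F[OF that]]
      psd_diff_mtrace_mult_le[OF dom psdD(1)[OF \<sigma>] psdD(1)[OF \<rho>] F[OF that]]
    by (auto simp: q_def r_def)
  \<comment> \<open>The maximiser of \<open>2 * a * q y - a\<^sup>2 * (r y + t * q y)\<close> over
    real \<open>a\<close> for \<open>q y > 0\<close>, with maximum
    \<open>q y / (r y / q y + t)\<close>.\<close>
  define a where "a y = q y / (r y + t * q y)" for y
  define X where "X w k = (\<Sum>y\<in>Y. of_real (a y) * app d (F y) w k)" for w k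
  have X_alt: "X w = (\<lambda>k. \<Sum>y\<in>Y. of_real (a y) * app d (F y) w k)" for w
    by (simp add: X_def fun_eq_iff)
  define x where "x i j = ip d (v j) (X (u i))" for i j
  have ipX: "ip d w (X w') = (\<Sum>y\<in>Y. of_real (a y) * ip d w (app d (F y) w'))" for w w'
    by (simp add: X_alt ip_sum_right ip_scale_right)
  have Xherm: "ip d w (X w') = ip d (X w) w'" for w w'
    by (simp add: ipX) (simp add: X_alt ip_sum_left ip_scale_left psd_hermitian[OF F])
  have Xnorm: "Re (ip d (X w) (X w)) \<le> (\<Sum>y\<in>Y. (a y)\<^sup>2 * Re (ip d w (app d (F y) w)))" for w
    unfolding X_alt by (rule povm_norm_le[OF povm])
  have "(\<Sum>y\<in>{y\<in>Y. 0 < q y}. q y / (r y / q y + t))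
      = (\<Sum>y\<in>{y\<in>Y. 0 < q y}. 2 * (a y * q y) - (a y)\<^sup>2 * r y - t * ((a y)\<^sup>2 * q y))"
  proof (rule sum.cong)
    fix y assume "y \<in> {y\<in>Y. 0 < q y}"
    then have y: "0 < q y" "0 \<le> r y" "0 < m * r y" using q[of y] by auto
    then have r: "0 < r y" by (auto simp: zero_less_mult_iff)
    define D where "D = r y + t * q y"
    have D: "0 < D" unfolding D_def using y r t by (simp add: add_pos_nonneg)
    have "2 * (a y * q y) - (a y)\<^sup>2 * r y - t * ((a y)\<^sup>2 * q y) = 2 * (a y * q y) - (a y)\<^sup>2 * D"
      by (simp add: D_def algebra_simps)
    also have "\<dots> = q y * q y / D"
      unfolding a_def D_def[symmetric] using D by (simp add: power2_eq_square field_simps)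
    also have "\<dots> = q y / (D / q y)" using y by simp
    also have "D / q y = r y / q y + t" using y by (simp add: D_def field_simps)
    finally show "q y / (r y / q y + t) = 2 * (a y * q y) - (a y)\<^sup>2 * r y - t * ((a y)\<^sup>2 * q y)" by simp
  qed simp
  also have "\<dots> = (\<Sum>y\<in>Y. 2 * (a y * q y) - (a y)\<^sup>2 * r y - t * ((a y)\<^sup>2 * q y))"
  proof (rule sum.mono_neutral_left)
    show "\<forall>y\<in>Y - {y \<in> Y. 0 < q y}. 2 * (a y * q y) - (a y)\<^sup>2 * r y - t * ((a y)\<^sup>2 * q y) = 0"
    proof
      fix y assume "y \<in> Y - {y \<in> Y. 0 < q y}"
      then have "q y = 0" using q(1)[of y] by auto
      then show "2 * (a y * q y) - (a y)\<^sup>2 * r y - t * ((a y)\<^sup>2 * q y) = 0" by (simp add: a_def)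
    qed
  qed (use fin in auto)
  also have "\<dots> = 2 * (\<Sum>y\<in>Y. a y * q y) - (\<Sum>y\<in>Y. (a y)\<^sup>2 * r y) - t * (\<Sum>y\<in>Y. (a y)\<^sup>2 * q y)"
    by (simp add: sum_subtractf sum_distrib_left)
  also have "\<dots> = 2 * (\<Sum>i<d. lam i * (\<Sum>y\<in>Y. a y * Re (ip d (u i) (app d (F y) (u i)))))
      - (\<Sum>j<d. mu j * (\<Sum>y\<in>Y. (a y)\<^sup>2 * Re (ip d (v j) (app d (F y) (v j)))))
      - t * (\<Sum>i<d. lam i * (\<Sum>y\<in>Y. (a y)\<^sup>2 * Re (ip d (u i) (app d (F y) (u i)))))"
    unfolding q_def r_def povm_sum_mtrace[OF povm u \<rho>] povm_sum_mtrace[OF povm v \<sigma>] ..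
  \<comment> \<open>Both quadratic terms enter with a minus sign, so Kadison's inequality raises the
    total.\<close>
  also have "\<dots> \<le> 2 * (\<Sum>i<d. lam i * (\<Sum>y\<in>Y. a y * Re (ip d (u i) (app d (F y) (u i)))))
      - (\<Sum>j<d. mu j * Re (ip d (X (v j)) (X (v j))))
      - t * (\<Sum>i<d. lam i * Re (ip d (X (u i)) (X (u i))))"
    using t by (intro diff_mono order_refl mult_left_mono sum_mono Xnorm) (auto simp: lam_nonneg mu_nonneg)
  also have "(\<Sum>i<d. lam i * (\<Sum>y\<in>Y. a y * Re (ip d (u i) (app d (F y) (u i)))))
      = (\<Sum>i<d. lam i * Re (ip d (u i) (X (u i))))"
    by (simp add: ipX)
  also have "\<dots> = (\<Sum>i<d. \<Sum>j<d. lam i * Re (ip d (u i) (v j) * x i j))"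
    unfolding eigenbasis_parseval[OF v, of "u _" "X (u _)"] x_def Re_sum sum_distrib_left ..
  \<comment> \<open>The images of the \<open>v j\<close> are expanded in the basis \<open>u\<close>
    and those of the \<open>u i\<close> in the basis \<open>v\<close>; since \<open>X\<close> is
    hermitian, the same numbers \<open>x i j\<close> appear in both.\<close>
  also have "(\<Sum>j<d. mu j * Re (ip d (X (v j)) (X (v j)))) = (\<Sum>j<d. \<Sum>i<d. mu j * (cmod (x i j))\<^sup>2)"
  proof -
    have "cmod (ip d (u i) (X (v j))) = cmod (x i j)" for i j
      unfolding x_def Xherm[of "u i"] by (rule cmod_ip_commute)
    then show ?thesis
      unfolding eigenbasis_parseval_norm[OF u] by (simp add: sum_distrib_left)
  qed
  also have "\<dots> = (\<Sum>i<d. \<Sum>j<d. mu j * (cmod (x i j))\<^sup>2)" by (rule sum.swap)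
  also have "(\<Sum>i<d. lam i * Re (ip d (X (u i)) (X (u i)))) = (\<Sum>i<d. \<Sum>j<d. lam i * (cmod (x i j))\<^sup>2)"
    unfolding eigenbasis_parseval_norm[OF v] by (simp add: sum_distrib_left x_def)
  also have "2 * (\<Sum>i<d. \<Sum>j<d. lam i * Re (ip d (u i) (v j) * x i j)) - (\<Sum>i<d. \<Sum>j<d. mu j * (cmod (x i j))\<^sup>2)
      - t * (\<Sum>i<d. \<Sum>j<d. lam i * (cmod (x i j))\<^sup>2)
      = (\<Sum>i<d. \<Sum>j<d. 2 * (lam i * Re (ip d (u i) (v j) * x i j)) - (mu j + t * lam i) * (cmod (x i j))\<^sup>2)"
    by (simp add: sum_subtractf sum_distrib_left sum.distrib ring_distribs mult.assoc)
  also have "\<dots> \<le> (\<Sum>i<d. \<Sum>j<d. lam i * P i j / (mu j / lam i + t))"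
  proof (intro sum_mono)
    fix i j assume "i \<in> {..<d}" "j \<in> {..<d}"
    then have ij: "i < d" "j < d" by auto
    have D0: "0 \<le> mu j + t * lam i" using ij t by (simp add: lam_nonneg mu_nonneg)
    show "2 * (lam i * Re (ip d (u i) (v j) * x i j)) - (mu j + t * lam i) * (cmod (x i j))\<^sup>2
      \<le> lam i * P i j / (mu j / lam i + t)"
    proof (cases "(i,j) \<in> K")
      \<comment> \<open>Off \<open>K\<close> the linear term and the right side vanish, and the
        quadratic term only lowers the left side.\<close>
      case False
      have "0 \<le> lam i * P i j" using ij by (simp add: lam_nonneg P_nonneg)
      then have "lam i = 0 \<or> ip d (u i) (v j) = 0"
        using False ij by (auto simp: K_def P_def cmod_ip_commute[of d "v j"])
      moreover have "lam i * P i j = 0" using False ij \<open>0 \<le> lam i * P i j\<close> by (simp add: K_def)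
      ultimately show ?thesis using D0 by auto
    next
      case True
      note pos = K_pos[OF True]
      define D where "D = mu j + t * lam i"
      have D: "0 < D" unfolding D_def using pos t by (simp add: add_pos_nonneg)
      define c where "c = cmod (ip d (u i) (v j))"
      have "Re (ip d (u i) (v j) * x i j) \<le> c * cmod (x i j)"
        using complex_Re_le_cmod[of "ip d (u i) (v j) * x i j"] by (simp add: norm_mult c_def)
      then have "2 * (lam i * Re (ip d (u i) (v j) * x i j)) \<le> 2 * (lam i * (c * cmod (x i j)))"
        using pos by simp
      \<comment> \<open>Completing the square in \<open>cmod (x i j)\<close>.\<close>
      moreover have "0 \<le> (lam i * c - D * cmod (x i j))\<^sup>2 / D" using D by simp
      moreover have "(lam i * c - D * cmod (x i j))\<^sup>2 / D
          = lam i * lam i * c\<^sup>2 / D - 2 * (lam i * (c * cmod (x i j))) + D * (cmod (x i j))\<^sup>2"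
        using D by (simp add: power2_eq_square field_simps)
      moreover have "lam i * lam i * c\<^sup>2 / D = lam i * P i j / (mu j / lam i + t)"
      proof -
        have "mu j / lam i + t = D / lam i" using pos by (simp add: D_def field_simps)
        then show ?thesis by (simp add: P_def c_def cmod_ip_commute[of d "v j"])
      qed
      ultimately show ?thesis unfolding D_def[symmetric] by linarith
    qed
  qed
  also have "\<dots> = (\<Sum>(i,j)\<in>K. lam i * P i j / (mu j / lam i + t))"
    by (subst sum_K) auto
  finally show ?thesis .
qed

text \<open>Both sides are averages of \<open>- log 2\<close> under distributions of total mass 1,
  at the ratios \<open>r y / q y\<close> and \<open>mu j / lam i\<close>, so the resolvent
  comparison applies.\<close>

lemma measured_relative_entropy_le:
  assumes povm: "povm d Y F"
  defines "q \<equiv> \<lambda>y. Re (mtrace (\<rho> * F y))" and "r \<equiv> \<lambda>y. Re (mtrace (\<sigma> * F y))"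
  shows "(\<Sum>y\<in>Y. q y * log 2 (q y / r y))
    \<le> (\<Sum>i<d. eta (lam i)) - (\<Sum>j<d. log 2 (mu j) * Re (ip d (v j) (app d \<rho> (v j))))"
proof -
  have fin: "finite Y" and F: "\<And>y. y \<in> Y \<Longrightarrow> psd d (F y)" using povm by (auto simp: povm_def)
  have q: "0 \<le> q y" "0 \<le> r y" "q y \<le> m * r y" if "y \<in> Y" for y
    using psd_mtrace_mult_nonneg[OF \<rho> F[OF that]] psd_mtrace_mult_nonneg[OF \<sigma> F[OF that]]
      psd_diff_mtrace_mult_le[OF dom psdD(1)[OF \<sigma>] psdD(1)[OF \<rho>] F[OF that]]
    by (auto simp: q_def r_def)
  let ?L = "{y\<in>Y. 0 < q y}"
  \<comment> \<open>Domination passes to outcomes: \<open>q y \<le> m * r y\<close> excludes a zero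
    denominator.\<close>
  have r: "0 < r y" if "y \<in> ?L" for y
  proof -
    have "0 < m * r y" "0 \<le> r y" using q[of y] that by auto
    then show ?thesis by (auto simp: zero_less_mult_iff)
  qed
  have restrict: "(\<Sum>y\<in>Y. q y * g y) = (\<Sum>y\<in>?L. q y * g y)" for g
    using fin q by (intro sum.mono_neutral_right) (auto simp: order.order_iff_strict)
  have "(\<Sum>y\<in>Y. 1 * q y) = (\<Sum>i<d. lam i * (\<Sum>y\<in>Y. 1 * Re (ip d (u i) (app d (F y) (u i)))))"
    unfolding q_def by (rule povm_sum_mtrace[OF povm u \<rho>])
  also have "\<dots> = (\<Sum>i<d. lam i * Re (ip d (u i) (\<lambda>k. \<Sum>y\<in>Y. app d (F y) (u i) k)))"
    by (simp add: ip_sum_right)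
  also have "\<dots> = (\<Sum>i<d. lam i * Re (ip d (u i) (u i)))"
    using povm_app[OF povm] by (intro sum.cong refl arg_cong2[where f = "(*)"] arg_cong[where f = Re] ip_cong) auto
  also have "\<dots> = 1" by (simp add: eigenbasis_self[OF u] sum_lam)
  finally have mass: "sum q ?L = 1" using restrict[of "\<lambda>_. 1"] by simp
  have "(\<Sum>k\<in>K. (case k of (i,j) \<Rightarrow> lam i * P i j) * log 2 (case k of (i,j) \<Rightarrow> mu j / lam i))
      \<le> (\<Sum>y\<in>?L. q y * log 2 (r y / q y))"
  proof (rule sum_log_le_if_resolvent_le)
    show "(\<Sum>k\<in>K. case k of (i,j) \<Rightarrow> lam i * P i j) = sum q ?L"
      using sum_K_mass mass by simp
    show "0 < (case k of (i,j) \<Rightarrow> mu j / lam i)" if "k \<in> K" for k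
      using that K_pos[of "fst k" "snd k"] by (cases k) auto
    show "0 < r y / q y" if "y \<in> ?L" for y using that r[OF that] by simp
    show "(\<Sum>y\<in>?L. q y / (r y / q y + t))
        \<le> (\<Sum>k\<in>K. (case k of (i,j) \<Rightarrow> lam i * P i j) / ((case k of (i,j) \<Rightarrow> mu j / lam i) + t))"
      if "0 \<le> t" for t
      using povm_resolvent_le[OF povm that] by (simp add: q_def r_def case_prod_unfold)
  qed
  moreover have "(\<Sum>y\<in>Y. q y * log 2 (q y / r y)) = - (\<Sum>y\<in>?L. q y * log 2 (r y / q y))"
    unfolding restrict sum_negf[symmetric] using r
    by (intro sum.cong) (auto simp: log_divide_pos algebra_simps)
  ultimately show ?thesis unfolding relative_entropy_eq by (simp add: case_prod_unfold)
qed

end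

section \<open>The Holevo information\<close>

text \<open>If \<open>v\<close> and \<open>mu\<close> diagonalise \<open>\<sigma>\<close>, this is the relative entropy of \<open>\<rho>\<close> and \<open>\<sigma>\<close>. Where
  \<open>mu j = 0\<close>, the junk value \<open>log 2 0\<close> is harmless if \<open>\<rho>\<close> is dominated by a multiple of \<open>\<sigma>\<close>, since
  then its factor vanishes.\<close>
definition rel_entropy :: "nat \<Rightarrow> complex mat \<Rightarrow> (nat \<Rightarrow> nat \<Rightarrow> complex) \<Rightarrow> (nat \<Rightarrow> real) \<Rightarrow> real" where
  "rel_entropy d \<rho> v mu = - vn_entropy \<rho> - (\<Sum>j<d. log 2 (mu j) * Re (ip d (v j) (app d \<rho> (v j))))"

section \<open>Bounds on the relative entropy of density operators\<close>

lemma density_dominated_pair: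
  assumes "density d \<rho>" "psd d \<sigma>" "eigenbasis d \<sigma> v mu" "psd d (complex_of_real m \<cdot>\<^sub>m \<sigma> - \<rho>)"
  obtains u lam where "dominated_pair d \<rho> \<sigma> u v lam mu m" "vn_entropy \<rho> = - (\<Sum>i<d. eta (lam i))"
proof -
  have \<rho>: "psd d \<rho>" "mtrace \<rho> = 1" using assms(1) by (auto simp: density_def)
  obtain u lam where "eigenbasis d \<rho> u lam" "vn_entropy \<rho> = - (\<Sum>i<d. eta (lam i))"
    by (rule psd_eigenbasis[OF \<rho>(1)])
  with \<rho> assms show ?thesis by (intro that) (unfold_locales, auto)
qed

lemma measured_le_rel_entropy:
  assumes "density d \<rho>" "psd d \<sigma>" "eigenbasis d \<sigma> v mu" "psd d (complex_of_real m \<cdot>\<^sub>m \<sigma> - \<rho>)" "povm d Y F"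
  shows "(\<Sum>y\<in>Y. Re (mtrace (\<rho> * F y)) * log 2 (Re (mtrace (\<rho> * F y)) / Re (mtrace (\<sigma> * F y))))
    \<le> rel_entropy d \<rho> v mu"
proof -
  obtain u lam where "dominated_pair d \<rho> \<sigma> u v lam mu m" "vn_entropy \<rho> = - (\<Sum>i<d. eta (lam i))"
    by (rule density_dominated_pair[OF assms(1-4)])
  then show ?thesis
    using dominated_pair.measured_relative_entropy_le[OF _ assms(5)] by (simp add: rel_entropy_def)
qed

lemma rel_entropy_le_log:
  assumes "density d \<rho>" "psd d \<sigma>" "eigenbasis d \<sigma> v mu" "psd d (complex_of_real m \<cdot>\<^sub>m \<sigma> - \<rho>)"
  shows "0 < m" "rel_entropy d \<rho> v mu \<le> log 2 m"
proof -
  obtain u lam where "dominated_pair d \<rho> \<sigma> u v lam mu m" "vn_entropy \<rho> = - (\<Sum>i<d. eta (lam i))"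
    by (rule density_dominated_pair[OF assms])
  then show "0 < m" "rel_entropy d \<rho> v mu \<le> log 2 m"
    using dominated_pair.relative_entropy_le_log dominated_pair.m_pos by (simp_all add: rel_entropy_def)
qed

lemma povm_trivial: "povm d {0} (\<lambda>_. 1\<^sub>m d)"
proof -
  have "app d (1\<^sub>m d) v k = v k" if "k < d" for v k
  proof -
    have "app d (1\<^sub>m d) v k = (\<Sum>l<d. if k = l then v l else 0)"
      unfolding app_def using that by (intro sum.cong) auto
    then show ?thesis using that by simp
  qed
  then have eq: "ip d v (app d (1\<^sub>m d) v) = ip d v v" for v by (intro ip_cong) auto
  have "psd d (1\<^sub>m d)"
    by (rule psdI) (auto simp: eq ip_self intro!: sum_nonneg)
  then show ?thesis by (auto simp: povm_def msum_def)
qed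

text \<open>The trivial measurement has its single outcome with probability 1 in both states, so the
  measured relative entropy is \<open>1 * log 2 1 = 0\<close>.\<close>

lemma rel_entropy_nonneg:
  assumes "density d \<rho>" "density d \<sigma>" "eigenbasis d \<sigma> v mu" "psd d (complex_of_real m \<cdot>\<^sub>m \<sigma> - \<rho>)"
  shows "0 \<le> rel_entropy d \<rho> v mu"
proof -
  have "psd d \<rho>" "mtrace \<rho> = 1" "psd d \<sigma>" "mtrace \<sigma> = 1" using assms by (auto simp: density_def)
  then show ?thesis
    using measured_le_rel_entropy[OF assms(1) _ assms(3,4) povm_trivial] psdD(1)[of d \<rho>] psdD(1)[of d \<sigma>]
    by simp
qed

text \<open>Every admissible factor is at least 2 to the power of the relative entropy, hence so is
  the infimum; this also makes the infimum positive, as taking its logarithm requires.\<close>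

lemma rel_entropy_le_D_max:
  assumes "density d \<rho>" "psd d \<sigma>" "eigenbasis d \<sigma> v mu"
  shows "ereal (rel_entropy d \<rho> v mu) \<le> D_max d \<rho> \<sigma>"
proof -
  define S where "S = {\<mu>::real. psd d (complex_of_real \<mu> \<cdot>\<^sub>m \<sigma> - \<rho>)}"
  show ?thesis
  proof (cases "S = {}")
    case False
    have "2 powr rel_entropy d \<rho> v mu \<le> \<mu>" if "\<mu> \<in> S" for \<mu>
      using rel_entropy_le_log[OF assms, of \<mu>] that by (simp add: S_def le_log_iff)
    then have "2 powr rel_entropy d \<rho> v mu \<le> Inf S" using False by (intro cInf_greatest) auto
    moreover from this have "0 < Inf S" by (rule less_le_trans[rotated]) simp
    ultimately have "rel_entropy d \<rho> v mu \<le> log 2 (Inf S)" by (simp add: le_log_iff)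
    then show ?thesis using False by (simp add: D_max_def S_def Let_def)
  qed (simp add: D_max_def S_def Let_def)
qed

section \<open>Mixtures of states\<close>

lemma avg_state_carrier: "avg_state d X p \<rho> \<in> carrier_mat d d"
  by (simp add: avg_state_def msum_def)

lemma avg_state_index:
  assumes "\<And>x. x \<in> X \<Longrightarrow> \<rho> x \<in> carrier_mat d d" "k < d" "l < d"
  shows "avg_state d X p \<rho> $$ (k,l) = (\<Sum>x\<in>X. of_real (p x) * \<rho> x $$ (k,l))"
proof -
  have "(complex_of_real (p x) \<cdot>\<^sub>m \<rho> x) $$ (k,l) = of_real (p x) * \<rho> x $$ (k,l)" if "x \<in> X" for x
    using assms(1)[OF that] assms(2,3) by simp
  then show ?thesis using assms(2,3) by (simp add: avg_state_def msum_def)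
qed

lemma avg_state_ip:
  assumes "\<And>x. x \<in> X \<Longrightarrow> \<rho> x \<in> carrier_mat d d"
  shows "ip d v (app d (avg_state d X p \<rho>) w) = (\<Sum>x\<in>X. of_real (p x) * ip d v (app d (\<rho> x) w))"
proof -
  have "app d (avg_state d X p \<rho>) w k = (\<Sum>x\<in>X. of_real (p x) * app d (\<rho> x) w k)" if "k < d" for k
    using that by (simp add: app_def avg_state_index[OF assms] sum_distrib_left sum_distrib_right
        sum.swap[of _ X] mult.assoc)
  then have "ip d v (app d (avg_state d X p \<rho>) w) = ip d v (\<lambda>k. \<Sum>x\<in>X. of_real (p x) * app d (\<rho> x) w k)"
    by (intro ip_cong) auto
  then show ?thesis by (simp add: ip_sum_right ip_scale_right)
qed

lemma avg_state_mtrace_mult: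
  assumes "\<And>x. x \<in> X \<Longrightarrow> \<rho> x \<in> carrier_mat d d" "M \<in> carrier_mat d d"
  shows "mtrace (avg_state d X p \<rho> * M) = (\<Sum>x\<in>X. of_real (p x) * mtrace (\<rho> x * M))"
proof -
  have tr: "mtrace (A * M) = (\<Sum>i<d. \<Sum>k<d. A $$ (i,k) * M $$ (k,i))" if "A \<in> carrier_mat d d" for A
    using that assms(2) by (subst mtrace_eq[of _ d]) (auto simp del: index_mult_mat simp: mult_mat_index)
  have "mtrace (avg_state d X p \<rho> * M) = (\<Sum>i<d. \<Sum>k<d. \<Sum>x\<in>X. of_real (p x) * (\<rho> x $$ (i,k) * M $$ (k,i)))"
    by (simp add: tr[OF avg_state_carrier] avg_state_index[OF assms(1)] sum_distrib_right mult.assoc)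
  also have "\<dots> = (\<Sum>x\<in>X. \<Sum>i<d. \<Sum>k<d. of_real (p x) * (\<rho> x $$ (i,k) * M $$ (k,i)))"
    by (simp add: sum.swap[of _ X])
  also have "\<dots> = (\<Sum>x\<in>X. of_real (p x) * mtrace (\<rho> x * M))"
    using assms(1) by (intro sum.cong) (auto simp: tr sum_distrib_left)
  finally show ?thesis .
qed

lemma avg_state_density:
  assumes \<rho>: "\<And>x. x \<in> X \<Longrightarrow> density d (\<rho> x)" and p: "\<And>x. x \<in> X \<Longrightarrow> 0 \<le> p x" "sum p X = 1"
  shows "density d (avg_state d X p \<rho>)"
proof -
  have psd: "psd d (\<rho> x)" and tr: "mtrace (\<rho> x) = 1" if "x \<in> X" for x
    using \<rho>[OF that] by (auto simp: density_def)
  note c = psdD(1)[OF psd]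
  have "psd d (avg_state d X p \<rho>)"
  proof (rule psdI)
    fix v
    show "Im (ip d v (app d (avg_state d X p \<rho>) v)) = 0"
      by (simp add: avg_state_ip[OF c] psdD(2)[OF psd])
    show "0 \<le> Re (ip d v (app d (avg_state d X p \<rho>) v))"
      by (simp add: avg_state_ip[OF c]) (intro sum_nonneg mult_nonneg_nonneg p(1) psdD(3)[OF psd])
  qed (rule avg_state_carrier)
  moreover have "mtrace (avg_state d X p \<rho>) = (\<Sum>x\<in>X. of_real (p x) * mtrace (\<rho> x))"
    using avg_state_mtrace_mult[of X \<rho> d "1\<^sub>m d" p] avg_state_carrier[of d X p \<rho>] c
    by (simp add: right_mult_one_mat[OF c])
  then have "mtrace (avg_state d X p \<rho>) = of_real (sum p X)" by (simp add: tr)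
  ultimately show ?thesis by (simp add: density_def p(2))
qed

lemma psd_smult_minusI:
  assumes "psd d \<sigma>" "psd d \<rho>" "\<And>w. Re (ip d w (app d \<rho> w)) \<le> m * Re (ip d w (app d \<sigma> w))"
  shows "psd d (complex_of_real m \<cdot>\<^sub>m \<sigma> - \<rho>)"
proof (rule psdI)
  note c = psdD(1)[OF assms(1)] psdD(1)[OF assms(2)]
  have eq: "ip d w (app d (complex_of_real m \<cdot>\<^sub>m \<sigma> - \<rho>) w)
      = complex_of_real m * ip d w (app d \<sigma> w) - ip d w (app d \<rho> w)" for w
  proof -
    have "ip d w (app d (complex_of_real m \<cdot>\<^sub>m \<sigma> - \<rho>) w)
      = ip d w (\<lambda>k. complex_of_real m * app d \<sigma> w k - app d \<rho> w k)"
      using c by (intro ip_cong) (auto simp: app_smult_minus)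
    then show ?thesis by (simp add: ip_diff_right ip_scale_right)
  qed
  show "Im (ip d w (app d (complex_of_real m \<cdot>\<^sub>m \<sigma> - \<rho>) w)) = 0" for w
    by (simp add: eq psdD(2)[OF assms(1)] psdD(2)[OF assms(2)])
  show "0 \<le> Re (ip d w (app d (complex_of_real m \<cdot>\<^sub>m \<sigma> - \<rho>) w))" for w
    using assms(3)[of w] by (simp add: eq)
qed (use psdD(1)[OF assms(1)] psdD(1)[OF assms(2)] in auto)

text \<open>Donald's identity. The cross term is linear in the state, so it averages to that of the
  mean state, and the remaining entropies combine to the Holevo information.\<close>

lemma holevo_info_donald:
  assumes "\<And>x. x \<in> X \<Longrightarrow> \<rho> x \<in> carrier_mat d d"
  shows "(\<Sum>x\<in>X. p x * rel_entropy d (\<rho> x) v mu)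
    = holevo_info d X p \<rho> + rel_entropy d (avg_state d X p \<rho>) v mu"
proof -
  have "(\<Sum>x\<in>X. p x * (\<Sum>j<d. log 2 (mu j) * Re (ip d (v j) (app d (\<rho> x) (v j)))))
    = (\<Sum>j<d. log 2 (mu j) * Re (ip d (v j) (app d (avg_state d X p \<rho>) (v j))))"
    by (simp add: avg_state_ip[OF assms] sum_distrib_left sum.swap[of _ X] algebra_simps)
  then show ?thesis
    by (simp add: rel_entropy_def holevo_info_def sum_subtractf sum_negf right_diff_distrib)
qed

lemma rel_entropy_self:
  assumes "eigenbasis d \<sigma> v mu" "vn_entropy \<sigma> = - (\<Sum>i<d. eta (mu i))"
  shows "rel_entropy d \<sigma> v mu = 0"
proof -
  have "(\<Sum>j<d. log 2 (mu j) * Re (ip d (v j) (app d \<sigma> (v j)))) = (\<Sum>j<d. eta (mu j))"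
  proof (rule sum.cong)
    fix j assume "j \<in> {..<d}"
    moreover from this have "0 \<le> mu j" using assms(1) by (simp add: eigenbasis_def)
    \<comment> \<open>For \<open>mu j = 0\<close> both sides are 0, whatever the value of
      \<open>log 2 0\<close>.\<close>
    ultimately show "log 2 (mu j) * Re (ip d (v j) (app d \<sigma> (v j))) = eta (mu j)"
      by (auto simp: eta_def eigenbasis_app[OF assms(1)] eigenbasis_self[OF assms(1)])
  qed simp
  then show ?thesis by (simp add: rel_entropy_def assms(2))
qed

section \<open>The three inequalities for an ensemble\<close>

locale ensemble =
  fixes X :: "'x set" and p :: "'x \<Rightarrow> real" and \<rho> :: "'x \<Rightarrow> complex mat" and d :: nat
  assumes fin: "finite X" and p_pos: "\<And>x. x \<in> X \<Longrightarrow> 0 < p x" and sum_p: "sum p X = 1"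
    and dens: "\<And>x. x \<in> X \<Longrightarrow> density d (\<rho> x)"
begin

lemma psd_state: "x \<in> X \<Longrightarrow> psd d (\<rho> x)" using dens by (simp add: density_def)

lemmas state_carrier = psdD(1)[OF psd_state]

lemma density_avg: "density d (avg_state d X p \<rho>)"
  by (rule avg_state_density) (auto simp: dens sum_p less_imp_le[OF p_pos])

text \<open>The average is \<open>p x\<close> times the state plus a positive semidefinite
  remainder; dividing by \<open>p x > 0\<close> gives the constant.\<close>

lemma state_dominated:
  assumes x: "x \<in> X"
  shows "psd d (complex_of_real (1 / p x) \<cdot>\<^sub>m avg_state d X p \<rho> - \<rho> x)"
proof (rule psd_smult_minusI)
  fix w
  have "p x * Re (ip d w (app d (\<rho> x) w)) \<le> (\<Sum>x\<in>X. p x * Re (ip d w (app d (\<rho> x) w)))"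
    by (rule member_le_sum[OF x _ fin, where f = "\<lambda>x. p x * Re (ip d w (app d (\<rho> x) w))"])
       (auto intro!: mult_nonneg_nonneg psdD(3)[OF psd_state] less_imp_le[OF p_pos])
  then show "Re (ip d w (app d (\<rho> x) w)) \<le> 1 / p x * Re (ip d w (app d (avg_state d X p \<rho>) w))"
    using p_pos[OF x] by (simp add: avg_state_ip[OF state_carrier] field_simps)
qed (use density_avg x in \<open>auto simp: density_def psd_state\<close>)

text \<open>Mutual information is the mean relative entropy of the conditional outcome distributions
  to that of the average state. Measuring decreases each term, and in Donald's identity the extra
  term is the relative entropy of the average state to itself.\<close>

lemma mutual_info_le_holevo_info:
  assumes povm: "povm d Y F"
  shows "mutual_info X p Y (\<lambda>x y. Re (mtrace (\<rho> x * F y))) \<le> holevo_info d X p \<rho>"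
proof -
  let ?\<sigma> = "avg_state d X p \<rho>"
  have \<sigma>: "psd d ?\<sigma>" using density_avg by (simp add: density_def)
  obtain v mu where v: "eigenbasis d ?\<sigma> v mu" "vn_entropy ?\<sigma> = - (\<Sum>i<d. eta (mu i))"
    by (rule psd_eigenbasis[OF \<sigma>])
  have F: "F y \<in> carrier_mat d d" if "y \<in> Y" for y using povm that by (auto simp: povm_def intro: psdD(1))
  have r: "(\<Sum>x\<in>X. p x * Re (mtrace (\<rho> x * F y))) = Re (mtrace (?\<sigma> * F y))" if "y \<in> Y" for y
    by (simp add: avg_state_mtrace_mult[OF state_carrier F[OF that]])
  have "mutual_info X p Y (\<lambda>x y. Re (mtrace (\<rho> x * F y)))
      = (\<Sum>x\<in>X. \<Sum>y\<in>Y. p x * (Re (mtrace (\<rho> x * F y)) * log 2 (Re (mtrace (\<rho> x * F y)) / Re (mtrace (?\<sigma> * F y)))))"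
    unfolding mutual_info_def Let_def
  proof (intro sum.cong refl)
    fix x y assume "x \<in> X" "y \<in> Y"
    \<comment> \<open>The factor \<open>p x\<close> cancels inside the logarithm, and the case of
      probability 0 is absorbed by the vanishing factor in front.\<close>
    then show "(if p x * Re (mtrace (\<rho> x * F y)) = 0 then 0
          else p x * Re (mtrace (\<rho> x * F y)) *
            log 2 (p x * Re (mtrace (\<rho> x * F y)) / (p x * (\<Sum>x\<in>X. p x * Re (mtrace (\<rho> x * F y))))))
      = p x * (Re (mtrace (\<rho> x * F y)) * log 2 (Re (mtrace (\<rho> x * F y)) / Re (mtrace (?\<sigma> * F y))))"
      using p_pos[of x] unfolding r[OF \<open>y \<in> Y\<close>] by simp
  qed
  also have "\<dots> = (\<Sum>x\<in>X. p x * (\<Sum>y\<in>Y. Re (mtrace (\<rho> x * F y)) * log 2 (Re (mtrace (\<rho> x * F y)) / Re (mtrace (?\<sigma> * F y)))))"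
    by (simp only: sum_distrib_left)
  also have "\<dots> \<le> (\<Sum>x\<in>X. p x * rel_entropy d (\<rho> x) v mu)"
    by (intro sum_mono mult_left_mono measured_le_rel_entropy[OF dens \<sigma> v(1) state_dominated povm])
       (auto intro: less_imp_le[OF p_pos])
  also have "\<dots> = holevo_info d X p \<rho>"
    by (simp add: holevo_info_donald[OF state_carrier] rel_entropy_self[OF v])
  finally show ?thesis .
qed

text \<open>Donald's identity and nonnegativity bound the Holevo information by the mean relative
  entropy to the mixture, hence by the largest one, hence by the largest
  \<open>D_max\<close>.\<close>

lemma holevo_info_le_Max_D_max:
  assumes \<pi>: "\<pi> \<in> pmfs_on X"
  shows "ereal (holevo_info d X p \<rho>) \<le> Max ((\<lambda>x. D_max d (\<rho> x) (avg_state d X \<pi> \<rho>)) ` X)"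
proof -
  let ?\<sigma> = "avg_state d X \<pi> \<rho>"
  let ?M = "Max ((\<lambda>x. D_max d (\<rho> x) ?\<sigma>) ` X)"
  have le_Max: "D_max d (\<rho> x) ?\<sigma> \<le> ?M" if "x \<in> X" for x using fin that by (intro Max_ge) auto
  have dens\<sigma>: "density d ?\<sigma>" using \<pi> by (intro avg_state_density dens) (auto simp: pmfs_on_def)
  then have \<sigma>: "psd d ?\<sigma>" by (simp add: density_def)
  obtain v mu where v: "eigenbasis d ?\<sigma> v mu" by (rule psd_eigenbasis[OF \<sigma>])
  show ?thesis
  proof (cases "\<exists>x\<in>X. D_max d (\<rho> x) ?\<sigma> = \<infinity>")
    case True
    then have "\<infinity> \<le> ?M" using le_Max by metis
    then show ?thesis by simp
  next
    case False
    have "\<exists>m. psd d (complex_of_real m \<cdot>\<^sub>m ?\<sigma> - \<rho> x)" if "x \<in> X" for x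
      using False that by (auto simp: D_max_def Let_def split: if_splits)
    then obtain m where m: "\<And>x. x \<in> X \<Longrightarrow> psd d (complex_of_real (m x) \<cdot>\<^sub>m ?\<sigma> - \<rho> x)" by metis
    \<comment> \<open>Averaging the dominations of the single states shows that the average state is
      dominated too, so its relative entropy is nonnegative.\<close>
    have "psd d (complex_of_real (\<Sum>x\<in>X. p x * m x) \<cdot>\<^sub>m ?\<sigma> - avg_state d X p \<rho>)"
    proof (rule psd_smult_minusI[OF \<sigma>])
      fix w
      have "(\<Sum>x\<in>X. p x * Re (ip d w (app d (\<rho> x) w))) \<le> (\<Sum>x\<in>X. p x * (m x * Re (ip d w (app d ?\<sigma> w))))"
        by (intro sum_mono mult_left_mono psd_diff_form_le[OF m avg_state_carrier state_carrier])
           (auto intro: less_imp_le[OF p_pos])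
      then show "Re (ip d w (app d (avg_state d X p \<rho>) w)) \<le> (\<Sum>x\<in>X. p x * m x) * Re (ip d w (app d ?\<sigma> w))"
        by (simp add: avg_state_ip[OF state_carrier, where p = p] sum_distrib_right mult.assoc)
    qed (use density_avg in \<open>simp add: density_def\<close>)
    from rel_entropy_nonneg[OF density_avg dens\<sigma> v this]
    have "holevo_info d X p \<rho> \<le> (\<Sum>x\<in>X. p x * rel_entropy d (\<rho> x) v mu)"
      by (simp add: holevo_info_donald[OF state_carrier])
    moreover have "X \<noteq> {}" using sum_p by auto
    then have "Max ((\<lambda>x. rel_entropy d (\<rho> x) v mu) ` X) \<in> (\<lambda>x. rel_entropy d (\<rho> x) v mu) ` X"
      using fin by (intro Max_in) auto
    then obtain x0 where "x0 \<in> X" "Max ((\<lambda>x. rel_entropy d (\<rho> x) v mu) ` X) = rel_entropy d (\<rho> x0) v mu"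
      by blast
    then have x0: "x0 \<in> X" "\<And>x. x \<in> X \<Longrightarrow> rel_entropy d (\<rho> x) v mu \<le> rel_entropy d (\<rho> x0) v mu"
      using fin by (metis Max_ge finite_imageI imageI)+
    then have "(\<Sum>x\<in>X. p x * rel_entropy d (\<rho> x) v mu) \<le> (\<Sum>x\<in>X. p x * rel_entropy d (\<rho> x0) v mu)"
      by (intro sum_mono mult_left_mono) (auto intro: less_imp_le[OF p_pos])
    ultimately have "holevo_info d X p \<rho> \<le> rel_entropy d (\<rho> x0) v mu"
      by (simp add: sum_distrib_right[symmetric] sum_p)
    then have "ereal (holevo_info d X p \<rho>) \<le> ereal (rel_entropy d (\<rho> x0) v mu)" by simp
    also have "\<dots> \<le> D_max d (\<rho> x0) ?\<sigma>" by (rule rel_entropy_le_D_max[OF dens[OF x0(1)] \<sigma> v])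
    also have "\<dots> \<le> ?M" by (rule le_Max[OF x0(1)])
    finally show ?thesis .
  qed
qed

text \<open>A point mass at \<open>x0\<close> is an admissible mixture with average state
  \<open>\<rho> x0\<close>; its value is a maximum over pairs with second entry \<open>x0\<close>
  only.\<close>

lemma B_quant_le_R_quant: "B_quant d X \<rho> \<le> R_quant d X \<rho>"
proof -
  obtain x0 where x0: "x0 \<in> X" using sum_p by fastforce
  define \<pi> :: "'x \<Rightarrow> real" where "\<pi> x = (if x = x0 then 1 else 0)" for x
  have "avg_state d X \<pi> \<rho> = \<rho> x0"
  proof (rule eq_matI)
    fix k l assume "k < dim_row (\<rho> x0)" "l < dim_col (\<rho> x0)"
    then have kl: "k < d" "l < d" using state_carrier[OF x0] by auto
    have "avg_state d X \<pi> \<rho> $$ (k,l) = (\<Sum>x\<in>X. of_real (\<pi> x) * \<rho> x $$ (k,l))"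
      by (rule avg_state_index[OF state_carrier kl])
    also have "\<dots> = (\<Sum>x\<in>X. if x = x0 then \<rho> x $$ (k,l) else 0)"
      by (intro sum.cong) (auto simp: \<pi>_def)
    finally show "avg_state d X \<pi> \<rho> $$ (k,l) = \<rho> x0 $$ (k,l)" using x0 fin by simp
  qed (use state_carrier[OF x0] avg_state_carrier[of d X \<pi> \<rho>] in auto)
  moreover have "\<pi> \<in> pmfs_on X" using x0 fin by (simp add: pmfs_on_def \<pi>_def)
  ultimately have "B_quant d X \<rho> \<le> Max ((\<lambda>x. D_max d (\<rho> x) (\<rho> x0)) ` X)"
    unfolding B_quant_def by (intro INF_lower2[of \<pi>]) simp_all
  also have "\<dots> \<le> R_quant d X \<rho>"
    unfolding R_quant_def using x0 fin by (intro Max_mono) auto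
  finally show ?thesis .
qed

end

theorem proposition5:
  fixes X :: "'x set" and p :: "'x \<Rightarrow> real" and \<rho> :: "'x \<Rightarrow> complex mat" and d :: nat
  assumes "finite X"
    and "\<forall>x\<in>X. 0 < p x"
    and "(\<Sum>x\<in>X. p x) = 1"
    and "\<forall>x\<in>X. density d (\<rho> x)"
  shows "accessible_info d X p \<rho> \<le> ereal (holevo_info d X p \<rho>)
       \<and> ereal (holevo_info d X p \<rho>) \<le> B_quant d X \<rho>
       \<and> B_quant d X \<rho> \<le> R_quant d X \<rho>"
proof -
  interpret ensemble X p \<rho> d using assms by unfold_locales auto
  have "accessible_info d X p \<rho> \<le> ereal (holevo_info d X p \<rho>)"
    unfolding accessible_info_def by (intro SUP_least) (auto intro: mutual_info_le_holevo_info)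
  moreover have "ereal (holevo_info d X p \<rho>) \<le> B_quant d X \<rho>"
    unfolding B_quant_def by (intro INF_greatest holevo_info_le_Max_D_max)
  ultimately show ?thesis using B_quant_le_R_quant by blast
qed

end
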